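(* Consider a radial network with node set $\mathcal{N}=\{0\}\cup\mathcal{N}^+$ and branch set $\mathcal{E}$, with the data described in the context, and assume: (A1) the convex objective function $f$ is bounded from below; (A2) $\overline{v}_i>v_0>\underline{v}_i>0$ for all $i\in\mathcal{N}^+$; (A3) $r_{ij}>0$ and $x_{ij}>0$ for all $(i,j)\in\mathcal{E}$. Suppose that at least one of the following three conditions holds: (C1) for every $i\in\mathcal{N}^+$, at least one of the following holds (possibly a different one for different $i$): (i) $\underline{p}_i\le 0\le\overline{p}_i$ and $\underline{q}_i<0<\overline{q}_i$; (ii) $\underline{p}_i<0<\overline{p}_i$ and $\underline{q}_i\le 0\le\overline{q}_i$; (iii) $\underline{p}_i<0\le\overline{p}_i$ and $\underline{q}_i<0\le\overline{q}_i$; (iv) $\underline{p}_i\le 0<\overline{p}_i$ and $\underline{q}_i\le 0<\overline{q}_i$; (C2) $r_{ij}/x_{ij}\ge r_{ki}/x_{ki}$ for all $(i,j),(k,i)\in\mathcal{E}$, and $\underline{p}_i<0\le\overline{p}_i$, $\underline{q}_i\le 0\le\overline{q}_i$ for all $i\in\mathcal{N}^+$; (C3) $r_{ij}/x_{ij}\le r_{ki}/x_{ki}$ for all $(i,j),(k,i)\in\mathcal{E}$, and $\underline{p}_i\le 0\le\overline{p}_i$, $\underline{q}_i<0\le\overline{q}_i$ for all $i\in\mathcal{N}^+$. Then the problems OPF-SOCP$_1$ and OPF-Cr are both strictly feasible, and consequently strong duality holds for each of them.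
   Context: **Network.** $\mathcal{N}=\{0\}\cup\mathcal{N}^+$ with $\mathcal{N}^+=\{1,\dots,n\}$ is the node set of a finite tree rooted at node $0$. Each $i\in\mathcal{N}^+$ has a unique parent $j$, and $\mathcal{E}$ is the set of branches $(i,j)$ with $i\in\mathcal{N}^+$ and $j$ the parent of $i$ (so there is exactly one branch $(i,j)$ for each $i\in\mathcal{N}^+$). The notation $k:k\to i$ means that $k$ ranges over the children of $i$, i.e. $(k,i)\in\mathcal{E}$. $\Gamma_i\subset\mathcal{E}$ denotes the set of branches on the unique path from $i$ to $0$. Empty sums are $0$. **Data.** For each $(i,j)\in\mathcal{E}$: impedance $z_{ij}=r_{ij}+\mathbf{i}x_{ij}\in\mathbb{C}$ ($\mathbf{i}$ the imaginary unit, $\bar z_{ij}$ the complex conjugate) and a bound $\overline{\ell}_{ij}>0$. For each $i\in\mathcal{N}^+$: real bounds $\underline{v}_i,\overline{v}_i,\underline{p}_i,\overline{p}_i,\underline{q}_i,\overline{q}_i$. A real constant $v_0$ (squared reference voltage at node $0$). The objective $f$ is a real-valued convex function of $(\mathrm{Re}(\vec{s}),\vec{v},\vec{\ell})$, where $\vec s=(s_i)_{i\in\mathcal{N}}$, $\vec v=(v_i)_{i\in\mathcal{N}^+}$, $\vec\ell=(\ell_{ij})_{(i,j)\in\mathcal{E}}$. **OPF-Cr.** Minimize $f(\mathrm{Re}(\vec s),\vec v,\vec\ell)$ over $S_{ij}\in\mathbb{C}$, $\ell_{ij}\in\mathbb{R}$ ($(i,j)\in\mathcal{E}$), $s_i\in\mathbb{C}$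 ($i\in\mathcal{N}$), $v_i\in\mathbb{R}$ ($i\in\mathcal{N}^+$) subject to - $s_i=S_{ij}-\sum_{k:k\to i}(S_{ki}-z_{ki}\ell_{ki})$ for all $(i,j)\in\mathcal{E}$; - $s_0=-\sum_{k:k\to 0}(S_{k0}-z_{k0}\ell_{k0})$; - $v_i-v_j=2\,\mathrm{Re}(\bar z_{ij}S_{ij})-|z_{ij}|^2\ell_{ij}$ for all $(i,j)\in\mathcal{E}$ (with $v_0$ the given constant); - $0\le\ell_{ij}\le\overline{\ell}_{ij}$ for all $(i,j)\in\mathcal{E}$; - $\underline{v}_i\le v_i\le\overline{v}_i$ for all $i\in\mathcal{N}^+$; - $\underline{p}_i\le\mathrm{Re}(s_i)\le\overline{p}_i$ and $\underline{q}_i\le\mathrm{Im}(s_i)\le\overline{q}_i$ for all $i\in\mathcal{N}^+$; - (conic constraint) $v_i\ell_{ij}\ge|S_{ij}|^2$ for all $(i,j)\in\mathcal{E}$. **OPF-SOCP$_1$.** This is OPF-Cr restricted to points parametrized by real variables $\tau_{ij}\ge 0$, $\beta_{ij}\in\mathbb{R}$ ($(i,j)\in\mathcal{E}$) via $S_{ij}=z_{ij}(\tau_{ij}-\beta_{ij})/|z_{ij}|^2$, $\ell_{ij}=\tau_{ij}/|z_{ij}|^2$, $s_i=\frac{z_{ij}}{|z_{ij}|^2}(\tau_{ij}-\beta_{ij})+\sum_{k:k\to i}\frac{z_{ki}}{|z_{ki}|^2}\beta_{ki}$ for $i\in\mathcal{N}^+$ with parent $j$, $s_0=\sum_{k:k\to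 0}\frac{z_{k0}}{|z_{k0}|^2}\beta_{k0}$, $v_i=v_0+\sum_{(m,n)\in\Gamma_i}(\tau_{mn}-2\beta_{mn})$. Explicitly: minimize $f$ evaluated at these expressions over $(\tau,\beta)$ subject to - (conic constraint) $\bigl(v_0+\sum_{(m,n)\in\Gamma_i}(\tau_{mn}-2\beta_{mn})\bigr)\tau_{ij}\ge(\tau_{ij}-\beta_{ij})^2$ for all $(i,j)\in\mathcal{E}$; - $0\le\tau_{ij}\le|z_{ij}|^2\overline{\ell}_{ij}$ for all $(i,j)\in\mathcal{E}$; - $\underline{v}_i-v_0\le\sum_{(m,n)\in\Gamma_i}(\tau_{mn}-2\beta_{mn})\le\overline{v}_i-v_0$ for all $i\in\mathcal{N}^+$; - $\underline{p}_i\le\frac{r_{ij}}{|z_{ij}|^2}(\tau_{ij}-\beta_{ij})+\sum_{k:k\to i}\frac{r_{ki}}{|z_{ki}|^2}\beta_{ki}\le\overline{p}_i$ for all $i\in\mathcal{N}^+$ (with parent $j$); - $\underline{q}_i\le\frac{x_{ij}}{|z_{ij}|^2}(\tau_{ij}-\beta_{ij})+\sum_{k:k\to i}\frac{x_{ki}}{|z_{ki}|^2}\beta_{ki}\le\overline{q}_i$ for all $i\in\mathcal{N}^+$ (with parent $j$). **Strict feasibility.** A problem is strictly feasible if it has a feasible point at which all non-affine (conic) inequality constraints hold with strict inequality. **Strong duality.** The conic constraints are read as membership in rotated second-order cones $\{(a,b,c): a\ge 0,\ b\ge 0,\ ab\ge|c|^2\}$ (with $(a,b,c)=(v_i,\ell_{ij},S_{ij})$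 for OPF-Cr, and $(a,b,c)=(v_0+\sum_{(m,n)\in\Gamma_i}(\tau_{mn}-2\beta_{mn}),\tau_{ij},\tau_{ij}-\beta_{ij})$ for OPF-SOCP$_1$). Strong duality means that the optimal value (infimum) of the problem equals the optimal value (supremum) of its Lagrangian conic dual, in which affine equalities receive free multipliers, affine inequalities receive nonnegative multipliers, and each conic constraint receives a multiplier in the dual cone; i.e. the duality gap is zero. *)

theory Defs
  imports "HOL-Analysis.Analysis"
begin

section \<open>Radial networks\<close>

text \<open>
  The non-root nodes are the elements of a finite type \<open>'n\<close>; the node set is \<open>'n option\<close>, where
  \<open>None\<close> is the root (node 0) and \<open>Some i\<close> is the non-root node \<open>i\<close>. Each non-root node has exactly
  one branch, to its parent, so every quantity indexed by a branch \<open>(i, j)\<close> is indexed by its lower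
  end \<open>i\<close>. The impedance is \<open>r + \<i> x\<close>, so \<open>r\<close> and \<open>x\<close> are its real and imaginary parts. The
  objective takes the real parts of all nodal injections (root included), the squared voltages
  of the non-root nodes, and the squared branch currents.
\<close>

record 'n opf_data =
  parent :: "'n \<Rightarrow> 'n option"
  imp :: "'n \<Rightarrow> complex"
  lmax :: "'n \<Rightarrow> real"
  vmin :: "'n \<Rightarrow> real"
  vmax :: "'n \<Rightarrow> real"
  pmin :: "'n \<Rightarrow> real"
  pmax :: "'n \<Rightarrow> real"
  qmin :: "'n \<Rightarrow> real"
  qmax :: "'n \<Rightarrow> real"
  vref :: real
  cost :: "(real^'n option) \<times> (real^'n) \<times> (real^'n) \<Rightarrow> real"

definition branches :: "('n::finite) opf_data \<Rightarrow> ('n option \<times> 'n option) set" where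
  "branches D = {(Some i, parent D i) | i. True}"

definition rooted_tree :: "('n::finite) opf_data \<Rightarrow> bool" where
  "rooted_tree D \<longleftrightarrow> (\<forall>a. (a, None) \<in> (branches D)\<^sup>*)"

definition children :: "('n::finite) opf_data \<Rightarrow> 'n option \<Rightarrow> 'n set" where
  "children D a = {k. (Some k, a) \<in> branches D}"

text \<open>
  The branches on the path from \<open>i\<close> to the root, again named by their lower ends. As following
  branches means moving to the parent, these lower ends are the non-root nodes reachable from \<open>i\<close>.
\<close>

definition path_branches :: "('n::finite) opf_data \<Rightarrow> 'n \<Rightarrow> 'n set" where
  "path_branches D i = {m. (Some i, Some m) \<in> (branches D)\<^sup>*}"

definition res :: "('n::finite) opf_data \<Rightarrow> 'n \<Rightarrow> real" where
  "res D i = Re (imp D i)"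

definition rea :: "('n::finite) opf_data \<Rightarrow> 'n \<Rightarrow> real" where
  "rea D i = Im (imp D i)"

definition zsq :: "('n::finite) opf_data \<Rightarrow> 'n \<Rightarrow> real" where
  "zsq D i = (cmod (imp D i))\<^sup>2"

definition volt :: "('n::finite) opf_data \<Rightarrow> real^'n \<Rightarrow> 'n option \<Rightarrow> real" where
  "volt D v a = (case a of None \<Rightarrow> vref D | Some i \<Rightarrow> v $ i)"


section \<open>Conic programs with rotated second-order cones\<close>

definition rotated_cone :: "(real \<times> real \<times> 'c::real_inner) set" where
  "rotated_cone = {(a, b, c). 0 \<le> a \<and> 0 \<le> b \<and> (norm c)\<^sup>2 \<le> a * b}"

definition dual_cone :: "'a::real_inner set \<Rightarrow> 'a set" where
  "dual_cone K = {y. \<forall>x\<in>K. 0 \<le> inner x y}"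

text \<open>
  Minimise \<open>objective x\<close> subject to \<open>eq_map x = 0\<close>, \<open>ineq_map x \<le> 0\<close> (componentwise) and
  \<open>cone_map x $ k \<in> rotated_cone\<close> for all \<open>k\<close>. Only programs with affine \<open>eq_map\<close>, \<open>ineq_map\<close>
  and \<open>cone_map\<close> are considered below.
\<close>

record ('x, 'e, 'm, 'c, 'k) conic_program =
  objective :: "'x \<Rightarrow> real"
  eq_map :: "'x \<Rightarrow> 'e"
  ineq_map :: "'x \<Rightarrow> 'm"
  cone_map :: "'x \<Rightarrow> (real \<times> real \<times> 'c)^'k"

type_synonym ('x, 'e, 'm, 'c, 'k) program = "('x, 'e, 'm, 'c, 'k) conic_program"

definition feasible ::
  "('x, 'e::real_inner, 'm::ordered_euclidean_space, 'c::real_inner, 'k::finite) program \<Rightarrow> 'x \<Rightarrow> bool"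
  where
  "feasible P x \<longleftrightarrow>
     eq_map P x = 0 \<and> ineq_map P x \<le> 0 \<and> (\<forall>k. cone_map P x $ k \<in> rotated_cone)"

definition strictly_feasible ::
  "('x, 'e::real_inner, 'm::ordered_euclidean_space, 'c::real_inner, 'k::finite) program \<Rightarrow> bool"
  where
  "strictly_feasible P \<longleftrightarrow>
     (\<exists>x. feasible P x \<and> (\<forall>k. case cone_map P x $ k of (a, b, c) \<Rightarrow> a * b > (norm c)\<^sup>2))"

definition primal_value ::
  "('x, 'e::real_inner, 'm::ordered_euclidean_space, 'c::real_inner, 'k::finite) program \<Rightarrow> ereal"
  where
  "primal_value P = (INF x\<in>{x. feasible P x}. ereal (objective P x))"

definition lagrangian ::
  "('x, 'e::real_inner, 'm::ordered_euclidean_space, 'c::real_inner, 'k::finite) program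
     \<Rightarrow> 'e \<Rightarrow> 'm \<Rightarrow> (real \<times> real \<times> 'c)^'k \<Rightarrow> 'x \<Rightarrow> real" where
  "lagrangian P \<kappa> \<mu> \<nu> x =
     objective P x + inner \<kappa> (eq_map P x) + inner \<mu> (ineq_map P x)
       - (\<Sum>k\<in>UNIV. inner (\<nu> $ k) (cone_map P x $ k))"

definition dual_value ::
  "('x, 'e::real_inner, 'm::ordered_euclidean_space, 'c::real_inner, 'k::finite) program \<Rightarrow> ereal"
  where
  "dual_value P =
     (SUP (\<kappa>, \<mu>, \<nu>)\<in>{(\<kappa>, \<mu>, \<nu>). 0 \<le> \<mu> \<and> (\<forall>k. \<nu> $ k \<in> dual_cone rotated_cone)}.
        INF x. ereal (lagrangian P \<kappa> \<mu> \<nu> x))"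

definition strong_duality ::
  "('x, 'e::real_inner, 'm::ordered_euclidean_space, 'c::real_inner, 'k::finite) program \<Rightarrow> bool"
  where
  "strong_duality P \<longleftrightarrow> primal_value P = dual_value P"


section \<open>OPF-Cr\<close>

text \<open>A point is \<open>(S, l, s, v)\<close>.\<close>

type_synonym 'n cr_point = "(complex^'n) \<times> (real^'n) \<times> (complex^'n option) \<times> (real^'n)"

type_synonym 'n bounds =
  "(real^'n) \<times> (real^'n) \<times> (real^'n) \<times> (real^'n) \<times> (real^'n) \<times> (real^'n) \<times> (real^'n) \<times> (real^'n)"

fun cr_objective :: "('n::finite) opf_data \<Rightarrow> 'n cr_point \<Rightarrow> real" where
  "cr_objective D (S, l, s, v) = cost D (\<chi> a. Re (s $ a), v, l)"

fun cr_eq :: "('n::finite) opf_data \<Rightarrow> 'n cr_point \<Rightarrow> (complex^'n) \<times> complex \<times> (real^'n)" where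
  "cr_eq D (S, l, s, v) =
    (\<chi> i. s $ Some i - (S $ i - (\<Sum>k\<in>children D (Some i). S $ k - imp D k * of_real (l $ k))),
     s $ None - (- (\<Sum>k\<in>children D None. S $ k - imp D k * of_real (l $ k))),
     \<chi> i. (v $ i - volt D v (parent D i)) - (2 * Re (cnj (imp D i) * S $ i) - zsq D i * l $ i))"

fun cr_ineq :: "('n::finite) opf_data \<Rightarrow> 'n cr_point \<Rightarrow> 'n bounds" where
  "cr_ineq D (S, l, s, v) =
    (\<chi> i. 0 - l $ i, \<chi> i. l $ i - lmax D i,
     \<chi> i. vmin D i - v $ i, \<chi> i. v $ i - vmax D i,
     \<chi> i. pmin D i - Re (s $ Some i), \<chi> i. Re (s $ Some i) - pmax D i,
     \<chi> i. qmin D i - Im (s $ Some i), \<chi> i. Im (s $ Some i) - qmax D i)"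

fun cr_cone :: "('n::finite) opf_data \<Rightarrow> 'n cr_point \<Rightarrow> (real \<times> real \<times> complex)^'n" where
  "cr_cone D (S, l, s, v) = (\<chi> i. (v $ i, l $ i, S $ i))"

definition OPF_Cr ::
  "('n::finite) opf_data
     \<Rightarrow> ('n cr_point, (complex^'n) \<times> complex \<times> (real^'n), 'n bounds, complex, 'n) program" where
  "OPF_Cr D =
    \<lparr>objective = cr_objective D, eq_map = cr_eq D, ineq_map = cr_ineq D, cone_map = cr_cone D\<rparr>"


section \<open>OPF-SOCP1\<close>

text \<open>
  A point is \<open>(\<tau>, \<beta>)\<close>; \<open>socp1_point\<close> is the point of OPF-Cr that it parametrises. The program has
  no equality constraints, which is encoded by the vacuous equation \<open>0 = 0\<close> over the reals; its
  multiplier does not occur in the value of the Lagrangian.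
\<close>

definition path_sum :: "('n::finite) opf_data \<Rightarrow> real^'n \<Rightarrow> real^'n \<Rightarrow> 'n \<Rightarrow> real" where
  "path_sum D \<tau> \<beta> i = (\<Sum>m\<in>path_branches D i. \<tau> $ m - 2 * \<beta> $ m)"

fun socp1_point :: "('n::finite) opf_data \<Rightarrow> (real^'n) \<times> (real^'n) \<Rightarrow> 'n cr_point" where
  "socp1_point D (\<tau>, \<beta>) =
    (\<chi> i. imp D i * of_real (\<tau> $ i - \<beta> $ i) / of_real (zsq D i),
     \<chi> i. \<tau> $ i / zsq D i,
     \<chi> a. (case a of
         None \<Rightarrow> (\<Sum>k\<in>children D None. imp D k / of_real (zsq D k) * of_real (\<beta> $ k))
       | Some i \<Rightarrow> imp D i / of_real (zsq D i) * of_real (\<tau> $ i - \<beta> $ i)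
           + (\<Sum>k\<in>children D (Some i). imp D k / of_real (zsq D k) * of_real (\<beta> $ k))),
     \<chi> i. vref D + path_sum D \<tau> \<beta> i)"

definition socp1_objective :: "('n::finite) opf_data \<Rightarrow> (real^'n) \<times> (real^'n) \<Rightarrow> real" where
  "socp1_objective D x = cr_objective D (socp1_point D x)"

definition socp1_p :: "('n::finite) opf_data \<Rightarrow> real^'n \<Rightarrow> real^'n \<Rightarrow> 'n \<Rightarrow> real" where
  "socp1_p D \<tau> \<beta> i = res D i / zsq D i * (\<tau> $ i - \<beta> $ i)
     + (\<Sum>k\<in>children D (Some i). res D k / zsq D k * \<beta> $ k)"

definition socp1_q :: "('n::finite) opf_data \<Rightarrow> real^'n \<Rightarrow> real^'n \<Rightarrow> 'n \<Rightarrow> real" where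
  "socp1_q D \<tau> \<beta> i = rea D i / zsq D i * (\<tau> $ i - \<beta> $ i)
     + (\<Sum>k\<in>children D (Some i). rea D k / zsq D k * \<beta> $ k)"

fun socp1_ineq :: "('n::finite) opf_data \<Rightarrow> (real^'n) \<times> (real^'n) \<Rightarrow> 'n bounds" where
  "socp1_ineq D (\<tau>, \<beta>) =
    (\<chi> i. 0 - \<tau> $ i, \<chi> i. \<tau> $ i - zsq D i * lmax D i,
     \<chi> i. (vmin D i - vref D) - path_sum D \<tau> \<beta> i, \<chi> i. path_sum D \<tau> \<beta> i - (vmax D i - vref D),
     \<chi> i. pmin D i - socp1_p D \<tau> \<beta> i, \<chi> i. socp1_p D \<tau> \<beta> i - pmax D i,
     \<chi> i. qmin D i - socp1_q D \<tau> \<beta> i, \<chi> i. socp1_q D \<tau> \<beta> i - qmax D i)"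

fun socp1_cone :: "('n::finite) opf_data \<Rightarrow> (real^'n) \<times> (real^'n) \<Rightarrow> (real \<times> real \<times> real)^'n" where
  "socp1_cone D (\<tau>, \<beta>) = (\<chi> i. (vref D + path_sum D \<tau> \<beta> i, \<tau> $ i, \<tau> $ i - \<beta> $ i))"

definition OPF_SOCP1 ::
  "('n::finite) opf_data \<Rightarrow> ((real^'n) \<times> (real^'n), real, 'n bounds, real, 'n) program" where
  "OPF_SOCP1 D =
    \<lparr>objective = socp1_objective D, eq_map = (\<lambda>_. 0), ineq_map = socp1_ineq D,
     cone_map = socp1_cone D\<rparr>"


section \<open>The constraints in explicit form\<close>

lemma Cr_feasible_iff:
  fixes D :: "('n::finite) opf_data"
  assumes "\<And>i. 0 \<le> vmin D i"
  shows "feasible (OPF_Cr D) (S, l, s, v) \<longleftrightarrow>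
    (\<forall>i. s $ Some i = S $ i - (\<Sum>k\<in>children D (Some i). S $ k - imp D k * of_real (l $ k))) \<and>
    s $ None = - (\<Sum>k\<in>children D None. S $ k - imp D k * of_real (l $ k)) \<and>
    (\<forall>i. v $ i - volt D v (parent D i) = 2 * Re (cnj (imp D i) * S $ i) - zsq D i * l $ i) \<and>
    (\<forall>i. 0 \<le> l $ i \<and> l $ i \<le> lmax D i) \<and>
    (\<forall>i. vmin D i \<le> v $ i \<and> v $ i \<le> vmax D i) \<and>
    (\<forall>i. pmin D i \<le> Re (s $ Some i) \<and> Re (s $ Some i) \<le> pmax D i) \<and>
    (\<forall>i. qmin D i \<le> Im (s $ Some i) \<and> Im (s $ Some i) \<le> qmax D i) \<and>
    (\<forall>i. v $ i * l $ i \<ge> (cmod (S $ i))\<^sup>2)"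
proof -
  have eq: "eq_map (OPF_Cr D) (S, l, s, v) = 0 \<longleftrightarrow>
    (\<forall>i. s $ Some i = S $ i - (\<Sum>k\<in>children D (Some i). S $ k - imp D k * of_real (l $ k))) \<and>
    s $ None = - (\<Sum>k\<in>children D None. S $ k - imp D k * of_real (l $ k)) \<and>
    (\<forall>i. v $ i - volt D v (parent D i) = 2 * Re (cnj (imp D i) * S $ i) - zsq D i * l $ i)"
    unfolding OPF_Cr_def conic_program.simps cr_eq.simps zero_prod_def prod.inject vec_eq_iff
      vec_lambda_beta zero_index right_minus_eq ..
  have ineq: "ineq_map (OPF_Cr D) (S, l, s, v) \<le> 0 \<longleftrightarrow>
    (\<forall>i. 0 \<le> l $ i \<and> l $ i \<le> lmax D i) \<and>
    (\<forall>i. vmin D i \<le> v $ i \<and> v $ i \<le> vmax D i) \<and>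
    (\<forall>i. pmin D i \<le> Re (s $ Some i) \<and> Re (s $ Some i) \<le> pmax D i) \<and>
    (\<forall>i. qmin D i \<le> Im (s $ Some i) \<and> Im (s $ Some i) \<le> qmax D i)"
    unfolding OPF_Cr_def conic_program.simps cr_ineq.simps zero_prod_def Pair_le less_eq_vec_def
      vec_lambda_beta zero_index diff_le_0_iff_le by blast
  have cone: "(\<forall>i. cone_map (OPF_Cr D) (S, l, s, v) $ i \<in> rotated_cone) \<longleftrightarrow>
    (\<forall>i. 0 \<le> v $ i \<and> 0 \<le> l $ i \<and> (cmod (S $ i))\<^sup>2 \<le> v $ i * l $ i)"
    by (simp add: OPF_Cr_def rotated_cone_def)
  have "0 \<le> v $ i" if "vmin D i \<le> v $ i" for i
    using assms that order_trans by blast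
  then show ?thesis
    unfolding feasible_def eq ineq cone by blast
qed

lemma SOCP1_feasible_iff:
  fixes D :: "('n::finite) opf_data"
  assumes "\<And>i. 0 \<le> vmin D i"
  shows "feasible (OPF_SOCP1 D) (\<tau>, \<beta>) \<longleftrightarrow>
    (\<forall>i. (vref D + path_sum D \<tau> \<beta> i) * \<tau> $ i \<ge> (\<tau> $ i - \<beta> $ i)\<^sup>2) \<and>
    (\<forall>i. 0 \<le> \<tau> $ i \<and> \<tau> $ i \<le> zsq D i * lmax D i) \<and>
    (\<forall>i. vmin D i - vref D \<le> path_sum D \<tau> \<beta> i \<and> path_sum D \<tau> \<beta> i \<le> vmax D i - vref D) \<and>
    (\<forall>i. pmin D i \<le> socp1_p D \<tau> \<beta> i \<and> socp1_p D \<tau> \<beta> i \<le> pmax D i) \<and>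
    (\<forall>i. qmin D i \<le> socp1_q D \<tau> \<beta> i \<and> socp1_q D \<tau> \<beta> i \<le> qmax D i)"
proof -
  have ineq: "ineq_map (OPF_SOCP1 D) (\<tau>, \<beta>) \<le> 0 \<longleftrightarrow>
    (\<forall>i. 0 \<le> \<tau> $ i \<and> \<tau> $ i \<le> zsq D i * lmax D i) \<and>
    (\<forall>i. vmin D i - vref D \<le> path_sum D \<tau> \<beta> i \<and> path_sum D \<tau> \<beta> i \<le> vmax D i - vref D) \<and>
    (\<forall>i. pmin D i \<le> socp1_p D \<tau> \<beta> i \<and> socp1_p D \<tau> \<beta> i \<le> pmax D i) \<and>
    (\<forall>i. qmin D i \<le> socp1_q D \<tau> \<beta> i \<and> socp1_q D \<tau> \<beta> i \<le> qmax D i)"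
    unfolding OPF_SOCP1_def conic_program.simps socp1_ineq.simps zero_prod_def Pair_le
      less_eq_vec_def vec_lambda_beta zero_index diff_le_0_iff_le by blast
  have eq: "eq_map (OPF_SOCP1 D) (\<tau>, \<beta>) = 0"
    by (simp add: OPF_SOCP1_def)
  have cone: "(\<forall>i. cone_map (OPF_SOCP1 D) (\<tau>, \<beta>) $ i \<in> rotated_cone) \<longleftrightarrow>
    (\<forall>i. 0 \<le> vref D + path_sum D \<tau> \<beta> i \<and> 0 \<le> \<tau> $ i \<and>
      (\<tau> $ i - \<beta> $ i)\<^sup>2 \<le> (vref D + path_sum D \<tau> \<beta> i) * \<tau> $ i)"
    by (simp add: OPF_SOCP1_def rotated_cone_def)
  have "0 \<le> vref D + path_sum D \<tau> \<beta> i" if "vmin D i - vref D \<le> path_sum D \<tau> \<beta> i" for i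
    using assms[of i] that by linarith
  then show ?thesis
    unfolding feasible_def ineq cone using eq by blast
qed

end

theory Submission
  imports Defs
begin

text \<open>
  Strict feasibility: take \<open>\<tau> = \<epsilon>\<close> and \<open>\<beta> = \<epsilon> b\<close> with \<open>\<epsilon> > 0\<close> small. As \<open>v\<^sub>0 \<tau>\<close> is of first order
  in \<open>\<epsilon>\<close> and \<open>(\<tau> - \<beta>)\<^sup>2\<close> of second order, the conic constraints hold strictly, and the voltage
  bounds hold because \<open>v\<^sub>0\<close> satisfies them strictly. The nodal powers are linear in \<open>\<epsilon>\<close>, so
  only their signs in the direction \<open>(1, b)\<close> matter. These involve \<open>b\<close> at the node
  and at its children only, so \<open>b\<close> is chosen recursively from the leaves up: under (C1) by cancelling
  one of the powers or giving both the same sign, under (C2) and (C3) by cancelling one of them, where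
  \<open>b \<ge> 0\<close> is kept as an invariant and the ordering of the ratios makes the other power nonpositive.

  Strong duality: only the conic constraints need a Slater point. Their multiplier is obtained by
  separation over the polyhedron cut out by the affine constraints, whose own multipliers then come
  from Farkas' lemma; the latter holds because finitely generated cones are closed.
\<close>

section \<open>Lagrange multipliers for affine constraints\<close>

text \<open>The identity is required for every real \<open>u\<close>, not only for \<open>u\<close>
  in [0,1], so that subtracting \<open>f 0\<close> leaves a linear map.\<close>

definition affine_map :: "('a::real_vector \<Rightarrow> 'b::real_vector) \<Rightarrow> bool" where
  "affine_map f \<longleftrightarrow>
     (\<forall>x y u. f ((1 - u) *\<^sub>R x + u *\<^sub>R y) = (1 - u) *\<^sub>R f x + u *\<^sub>R f y)"

text \<open>Affine combinations with 0 give homogeneity; additivity then comes from writing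
  \<open>x + y\<close> as the midpoint of \<open>2 *\<^sub>R x\<close> and
  \<open>2 *\<^sub>R y\<close>.\<close>

lemma affine_map_linear_part:
  assumes "affine_map f"
  shows "linear (\<lambda>x. f x - f 0)"
proof (rule linearI)
  have *: "f ((1 - u) *\<^sub>R x + u *\<^sub>R y) = (1 - u) *\<^sub>R f x + u *\<^sub>R f y" for x y u
    using assms by (simp add: affine_map_def)
  have scale: "f (c *\<^sub>R x) = (1 - c) *\<^sub>R f 0 + c *\<^sub>R f x" for c x
    using *[of c 0 x] by simp
  show "f (c *\<^sub>R x) - f 0 = c *\<^sub>R (f x - f 0)" for c x
    by (simp add: scale algebra_simps)
  show "f (x + y) - f 0 = (f x - f 0) + (f y - f 0)" for x y
  proof -
    have "f (x + y) = (1/2) *\<^sub>R f (2 *\<^sub>R x) + (1/2) *\<^sub>R f (2 *\<^sub>R y)"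
      using *[of "1/2" "2 *\<^sub>R x" "2 *\<^sub>R y"] by simp
    moreover have "(1/2) *\<^sub>R f 0 + (1/2) *\<^sub>R f 0 = f 0"
      by (simp flip: scaleR_add_left)
    ultimately show ?thesis
      by (simp add: scale[of 2] algebra_simps)
  qed
qed

lemma affine_map_compose_linear:
  assumes "affine_map f" "linear L"
  shows "affine_map (\<lambda>x. L (f x))"
  using assms by (simp add: affine_map_def linear_add linear_scale)

lemma affine_map_Pair:
  "affine_map f \<Longrightarrow> affine_map g \<Longrightarrow> affine_map (\<lambda>x. (f x, g x))"
  by (simp add: affine_map_def)

lemma affine_map_vec_lambda:
  "(\<And>i. affine_map (\<lambda>x. f x i)) \<Longrightarrow> affine_map (\<lambda>x. \<chi> i. f x i)"
  by (simp add: affine_map_def vec_eq_iff)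

lemma affine_map_add:
  "affine_map f \<Longrightarrow> affine_map g \<Longrightarrow> affine_map (\<lambda>x. f x + g x)"
  by (simp add: affine_map_def scaleR_add_right scaleR_diff_right add_ac)

lemma affine_map_minus: "affine_map f \<Longrightarrow> affine_map (\<lambda>x. - f x)"
  by (simp add: affine_map_def)

lemma affine_map_diff:
  "affine_map f \<Longrightarrow> affine_map g \<Longrightarrow> affine_map (\<lambda>x. f x - g x)"
  by (simp add: affine_map_def scaleR_add_right scaleR_diff_right add_ac)

lemma affine_map_const: "affine_map (\<lambda>x. c)"
  by (simp add: affine_map_def algebra_simps)

lemma affine_map_ident: "affine_map (\<lambda>x. x)"
  by (simp add: affine_map_def)

lemma affine_map_sum:
  "(\<And>i. i \<in> I \<Longrightarrow> affine_map (f i)) \<Longrightarrow> affine_map (\<lambda>x. \<Sum>i\<in>I. f i x)"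
  by (induction I rule: infinite_finite_induct)
    (simp_all add: affine_map_const affine_map_add)

lemma affine_map_mult_left:
  fixes f :: "'a::real_vector \<Rightarrow> 'b::real_algebra"
  shows "affine_map f \<Longrightarrow> affine_map (\<lambda>x. c * f x)"
  by (simp add: affine_map_def distrib_left distrib_right)

lemma affine_map_mult_right:
  fixes f :: "'a::real_vector \<Rightarrow> 'b::real_algebra"
  shows "affine_map f \<Longrightarrow> affine_map (\<lambda>x. f x * c)"
  by (simp add: affine_map_def distrib_left distrib_right)

lemma affine_map_divide:
  fixes f :: "'a::real_vector \<Rightarrow> 'b::{real_algebra,field}"
  shows "affine_map f \<Longrightarrow> affine_map (\<lambda>x. f x / c)"
  by (simp add: affine_map_def divide_inverse distrib_left distrib_right)

lemma affine_map_of_real: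
  "affine_map f \<Longrightarrow> affine_map (\<lambda>x. of_real (f x) :: 'b::real_algebra_1)"
  by (rule affine_map_compose_linear) (auto intro: linearI simp: scaleR_conv_of_real)

lemma affine_map_case_option:
  "affine_map f \<Longrightarrow> (\<And>i. affine_map (g i)) \<Longrightarrow>
    affine_map (\<lambda>x. case a of None \<Rightarrow> f x | Some i \<Rightarrow> g i x)"
  by (cases a) simp_all

text \<open>The projections, \<open>Re\<close>, \<open>Im\<close> and the vector components enter as
  linear maps applied after an affine map, so the affinity of a constraint map follows from the
  shape of its term.\<close>

lemmas affine_map_intros =
  affine_map_Pair affine_map_vec_lambda affine_map_add affine_map_minus affine_map_diff
  affine_map_const affine_map_ident affine_map_sum affine_map_mult_left affine_map_mult_right
  affine_map_divide affine_map_of_real affine_map_case_option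
  affine_map_compose_linear[OF _ linear_fst] affine_map_compose_linear[OF _ linear_snd]
  affine_map_compose_linear[OF _ bounded_linear.linear[OF bounded_linear_Re]]
  affine_map_compose_linear[OF _ bounded_linear.linear[OF bounded_linear_Im]]
  affine_map_compose_linear[OF _ bounded_linear.linear[OF bounded_linear_vec_nth]]

lemma convex_on_compose_affine_map:
  assumes "convex_on UNIV f" "affine_map g"
  shows "convex_on UNIV (\<lambda>x. f (g x))"
proof (rule convex_onI)
  fix t :: real and x y
  assume "0 < t" "t < 1"
  then show "f (g ((1 - t) *\<^sub>R x + t *\<^sub>R y)) \<le> (1 - t) * f (g x) + t * f (g y)"
    using convex_onD[OF assms(1), of t "g x" "g y"] assms(2) by (simp add: affine_map_def)
qed simp

section \<open>Farkas' lemma and multipliers for affine constraints\<close>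

text \<open>The pairs \<open>(z, \<delta>)\<close> whose inequality
  \<open>z \<bullet> x \<le> \<delta>\<close> is certified by multipliers form a convex cone
  \<open>K\<close>. It contains the cone \<open>C\<close> spanned by finitely many certified
  inequalities, and \<open>C\<close> is closed. If \<open>(c, d)\<close> were outside
  \<open>C\<close>, a separating vector \<open>(y, t)\<close> would yield a feasible point at which
  \<open>c \<bullet> x \<le> d\<close> fails.\<close>

lemma affine_farkas:
  fixes h :: "'x::euclidean_space \<Rightarrow> 'e::euclidean_space"
    and g :: "'x \<Rightarrow> 'm::ordered_euclidean_space"
  assumes h: "affine_map h" and g: "affine_map g"
    and x0: "h x0 = 0" "g x0 \<le> 0"
    and le: "\<And>x. h x = 0 \<Longrightarrow> g x \<le> 0 \<Longrightarrow> c \<bullet> x \<le> d"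
  obtains \<kappa> \<mu> where "0 \<le> \<mu>" "\<And>x. c \<bullet> x - d \<le> \<kappa> \<bullet> h x + \<mu> \<bullet> g x"
proof -
  \<comment> \<open>Without the type restriction, rewriting with \<open>eucl_le\<close> loops on the reals.\<close>
  have le_iff: "x \<le> y \<longleftrightarrow> (\<forall>i\<in>Basis. x \<bullet> i \<le> y \<bullet> i)" for x y :: 'm
    by (rule eucl_le)
  define Lh where "Lh = (\<lambda>x. h x - h 0)"
  define Lg where "Lg = (\<lambda>x. g x - g 0)"
  have lin: "linear Lh" "linear Lg"
    unfolding Lh_def Lg_def using affine_map_linear_part h g by blast+
  have h_eq: "h x = Lh x + h 0" and g_eq: "g x = Lg x + g 0" for x
    by (simp_all add: Lh_def Lg_def)
  \<comment> \<open>\<open>H e\<close> and \<open>J b\<close> are the pairs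
    \<open>(z, \<delta>)\<close> for which \<open>z \<bullet> x - \<delta>\<close> is exactly
    \<open>e \<bullet> h x\<close> and \<open>b \<bullet> g x\<close>.\<close>
  define H where "H = (\<lambda>e. (adjoint Lh e, - (h 0 \<bullet> e)))"
  define J where "J = (\<lambda>b. (adjoint Lg b, - (g 0 \<bullet> b)))"
  \<comment> \<open>Equality multipliers are free, hence both signs of the basis in
    \<open>H\<close>; inequality multipliers are nonnegative, hence one sign in \<open>J\<close>.
    The pair \<open>(0, 1)\<close> allows the right-hand side to be weakened.\<close>
  define gens where "gens = H ` (Basis \<union> uminus ` Basis) \<union> J ` Basis \<union> {(0, 1)}"
  define K where "K = {(z, \<delta>). \<exists>\<kappa> \<mu>. 0 \<le> \<mu> \<and> (\<forall>x. z \<bullet> x - \<delta> \<le> \<kappa> \<bullet> h x + \<mu> \<bullet> g x)}"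
  have K_I: "(z, \<delta>) \<in> K" if "0 \<le> \<mu>" "\<And>x. z \<bullet> x - \<delta> \<le> \<kappa> \<bullet> h x + \<mu> \<bullet> g x" for \<mu> z \<delta> \<kappa>
    unfolding K_def using that by blast
  define C where "C = convex_cone hull gens"
  have "convex_cone K"
    unfolding convex_cone_iff
  proof (intro conjI ballI allI impI)
    show "0 \<in> K"
      unfolding zero_prod_def by (rule K_I[of 0 _ _ 0]) simp_all
  next
    fix p q assume "p \<in> K" "q \<in> K"
    then obtain z \<delta> z' \<delta>' \<kappa> \<mu> \<kappa>' \<mu>' where "p = (z, \<delta>)" "q = (z', \<delta>')" and mu: "0 \<le> \<mu>" "0 \<le> \<mu>'"
      and z: "\<And>x. z \<bullet> x - \<delta> \<le> \<kappa> \<bullet> h x + \<mu> \<bullet> g x" "\<And>x. z' \<bullet> x - \<delta>' \<le> \<kappa>' \<bullet> h x + \<mu>' \<bullet> g x"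
      unfolding K_def by blast
    moreover have "(z + z') \<bullet> x - (\<delta> + \<delta>') \<le> (\<kappa> + \<kappa>') \<bullet> h x + (\<mu> + \<mu>') \<bullet> g x" for x
      using z[of x] by (simp add: inner_add_left)
    moreover have "0 \<le> \<mu> + \<mu>'" using mu by (simp add: le_iff inner_add_left)
    ultimately show "p + q \<in> K"
      using K_I[of "\<mu> + \<mu>'" "z + z'" "\<delta> + \<delta>'" "\<kappa> + \<kappa>'"] by simp
  next
    fix p and a :: real assume "p \<in> K" "0 \<le> a"
    then obtain z \<delta> \<kappa> \<mu> where "p = (z, \<delta>)" and mu: "0 \<le> \<mu>"
      and z: "\<And>x. z \<bullet> x - \<delta> \<le> \<kappa> \<bullet> h x + \<mu> \<bullet> g x"
      unfolding K_def by blast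
    moreover have "(a *\<^sub>R z) \<bullet> x - a * \<delta> \<le> (a *\<^sub>R \<kappa>) \<bullet> h x + (a *\<^sub>R \<mu>) \<bullet> g x" for x
      using mult_left_mono[OF z[of x] \<open>0 \<le> a\<close>] by (simp add: algebra_simps)
    moreover have "0 \<le> a *\<^sub>R \<mu>" using mu \<open>0 \<le> a\<close> by (simp add: le_iff)
    ultimately show "a *\<^sub>R p \<in> K"
      using K_I[of "a *\<^sub>R \<mu>" "a *\<^sub>R z" "a * \<delta>" "a *\<^sub>R \<kappa>"] by simp
  qed
  moreover have "gens \<subseteq> K"
  proof -
    have "adjoint Lh e \<bullet> x + h 0 \<bullet> e = e \<bullet> h x" for e x
      using adjoint_works[OF lin(1), of x e]
      by (simp add: Lh_def inner_commute inner_diff_right)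
    then have "H e \<in> K" for e
      unfolding H_def by (intro K_I[of 0 _ _ e]) simp_all
    moreover have "adjoint Lg b \<bullet> x + g 0 \<bullet> b = b \<bullet> g x" for b x
      using adjoint_works[OF lin(2), of x b]
      by (simp add: Lg_def inner_commute inner_diff_right)
    then have "J b \<in> K" if "b \<in> Basis" for b
      unfolding J_def using that by (intro K_I[of b _ _ 0]) simp_all
    moreover have "(0, 1) \<in> K"
      by (rule K_I[of 0 _ _ 0]) simp_all
    ultimately show ?thesis unfolding gens_def by auto
  qed
  ultimately have "C \<subseteq> K"
    unfolding C_def by (simp add: hull_minimal)
  have "(c, d) \<in> C"
  proof (rule ccontr)
    assume "(c, d) \<notin> C"
    moreover have "closed C" "convex C" and cone: "convex_cone C"
      unfolding C_def gens_def
      by (auto intro!: closed_convex_cone_hull convex_convex_cone_hull convex_cone_convex_cone_hull)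
    ultimately obtain w \<beta> where w: "w \<bullet> (c, d) < \<beta>" "\<And>p. p \<in> C \<Longrightarrow> \<beta> < w \<bullet> p"
      using separating_hyperplane_closed_point[of C "(c, d)"] by blast
    obtain y t where yt: "w = (y, t)" by (cases w)
    have "0 \<in> C" using cone convex_cone_contains_0 by blast
    then have "\<beta> < 0" using w(2) by fastforce
    \<comment> \<open>A linear functional bounded below on a cone is nonnegative there: otherwise
      \<open>p\<close> can be rescaled until \<open>w \<bullet> p\<close> equals \<beta>.\<close>
    have nonneg: "0 \<le> w \<bullet> p" if "p \<in> C" for p
    proof (rule ccontr)
      assume neg: "\<not> 0 \<le> w \<bullet> p"
      then have "(\<beta> / (w \<bullet> p)) *\<^sub>R p \<in> C"
        using cone that \<open>\<beta> < 0\<close> by (intro convex_cone_scaleR) (auto simp: divide_nonpos_neg)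
      from w(2)[OF this] show False using neg by simp
    qed
    then have nonneg_gens: "0 \<le> w \<bullet> p" if "p \<in> gens" for p
      using that unfolding C_def by (blast intro: hull_inc)
    have "0 \<le> w \<bullet> (0, 1)"
      by (rule nonneg_gens) (simp add: gens_def)
    then have "0 \<le> t" by (simp add: yt)
    have Lh: "Lh y = t *\<^sub>R h 0"
    proof (rule euclidean_eqI)
      fix e :: 'e assume "e \<in> Basis"
      then have "0 \<le> w \<bullet> H e" "0 \<le> w \<bullet> H (- e)"
        by (auto simp: gens_def intro!: nonneg_gens)
      then show "Lh y \<bullet> e = (t *\<^sub>R h 0) \<bullet> e"
        by (simp add: yt H_def adjoint_works[OF lin(1)])
    qed
    have Lg: "t *\<^sub>R g 0 \<le> Lg y"
      unfolding le_iff
    proof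
      fix b :: 'm assume "b \<in> Basis"
      then have "0 \<le> w \<bullet> J b"
        by (auto simp: gens_def intro!: nonneg_gens)
      then show "(t *\<^sub>R g 0) \<bullet> b \<le> Lg y \<bullet> b"
        by (simp add: yt J_def adjoint_works[OF lin(2)])
    qed
    have neg: "c \<bullet> y + d * t < 0"
      using w(1) \<open>\<beta> < 0\<close> by (simp add: yt inner_commute mult.commute)
    show False
    proof (cases "t = 0")
      case False
      then have "0 < t" using \<open>0 \<le> t\<close> by simp
      \<comment> \<open>For positive \<open>t\<close> the separating vector normalises to a feasible
        point with \<open>c \<bullet> x > d\<close>.\<close>
      define x where "x = (- 1 / t) *\<^sub>R y"
      have "h x = 0"
        unfolding h_eq[of x] unfolding x_def linear_scale[OF lin(1)] Lh using \<open>0 < t\<close> by simp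
      moreover have "g x \<le> 0"
        unfolding g_eq[of x] unfolding x_def linear_scale[OF lin(2)]
        using Lg \<open>0 < t\<close> by (simp add: le_iff inner_diff_left field_simps)
      ultimately have "c \<bullet> x \<le> d" by (rule le)
      then show False
        using neg \<open>0 < t\<close> by (simp add: x_def field_simps)
    next
      case True
      \<comment> \<open>For \<open>t = 0\<close> the vector \<open>- y\<close> is a recession
        direction of the feasible set; the step \<open>s\<close> from \<open>x0\<close> is chosen so
        that \<open>c\<close> takes the value \<open>d + 1\<close>.\<close>
      define s where "s = (d - c \<bullet> x0 + 1) / - (c \<bullet> y)"
      have cy: "c \<bullet> y < 0" using neg True by simp
      have "0 \<le> s"
        unfolding s_def using le[OF x0] cy by (intro divide_nonneg_pos) auto
      have "h (x0 - s *\<^sub>R y) = 0"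
        using x0(1) Lh True h_eq[of x0]
        by (simp add: h_eq[of "x0 - s *\<^sub>R y"] linear_diff[OF lin(1)] linear_scale[OF lin(1)])
      moreover have "g (x0 - s *\<^sub>R y) = g x0 - s *\<^sub>R Lg y"
        using g_eq[of x0]
        by (simp add: g_eq[of "x0 - s *\<^sub>R y"] linear_diff[OF lin(2)] linear_scale[OF lin(2)])
      moreover have "g x0 - s *\<^sub>R Lg y \<le> 0"
      proof -
        have "0 \<le> s *\<^sub>R Lg y" using Lg True \<open>0 \<le> s\<close> by (simp add: le_iff)
        then show ?thesis using x0(2) by (fastforce simp: le_iff inner_diff_left)
      qed
      ultimately have "c \<bullet> (x0 - s *\<^sub>R y) \<le> d" using le by auto
      moreover have "s * (c \<bullet> y) = - (d - c \<bullet> x0 + 1)"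
        using cy by (simp add: s_def)
      ultimately show False by (simp add: inner_diff_right)
    qed
  qed
  then show ?thesis using \<open>C \<subseteq> K\<close> that unfolding K_def by blast
qed

text \<open>Separating the strict epigraph of \<open>f\<close> from \<open>A \<times> {..p}\<close>
  replaces \<open>f\<close> by an affine minorant for which the bound \<open>p\<close> still holds
  on \<open>A\<close>; Farkas' lemma then gives the multipliers. No interior point of
  \<open>A\<close> is required, because \<open>f\<close> is finite on the whole space.\<close>

lemma affine_multipliers:
  fixes h :: "'x::euclidean_space \<Rightarrow> 'e::euclidean_space"
    and g :: "'x \<Rightarrow> 'm::ordered_euclidean_space"
  assumes f: "convex_on UNIV f" and h: "affine_map h" and g: "affine_map g"
    and A: "A = {x. h x = 0 \<and> g x \<le> 0}" "convex A" and x0: "x0 \<in> A"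
    and le: "\<And>x. x \<in> A \<Longrightarrow> p \<le> f x"
  obtains \<kappa> \<mu> where "0 \<le> \<mu>" "\<And>x. p \<le> f x + \<kappa> \<bullet> h x + \<mu> \<bullet> g x"
proof -
  define S where "S = {(x, \<alpha>). f x < \<alpha>}"
  define T where "T = A \<times> {..p}"
  have "convex S"
  proof (rule convexI)
    fix X Y and u v :: real
    assume "X \<in> S" "Y \<in> S" and uv: "0 \<le> u" "0 \<le> v" "u + v = 1"
    then obtain x \<alpha> y \<beta> where XY: "X = (x, \<alpha>)" "Y = (y, \<beta>)" and lt: "f x < \<alpha>" "f y < \<beta>"
      unfolding S_def by blast
    have "f (u *\<^sub>R x + v *\<^sub>R y) \<le> u * f x + v * f y"
      using f uv by (simp add: convex_on_def)
    also have "\<dots> < u * \<alpha> + v * \<beta>"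
    proof (cases "u = 0")
      case True
      then show ?thesis using uv lt by simp
    next
      case False
      then have "u * f x < u * \<alpha>" using lt uv by simp
      moreover have "v * f y \<le> v * \<beta>" using lt uv by (simp add: mult_left_mono)
      ultimately show ?thesis by linarith
    qed
    finally show "u *\<^sub>R X + v *\<^sub>R Y \<in> S" by (simp add: S_def XY)
  qed
  moreover have "convex T" unfolding T_def using A(2) by (intro convex_Times) auto
  moreover have "S \<noteq> {}" unfolding S_def using lt_ex[of "f x0"] gt_ex[of "f x0"] by blast
  moreover have "T \<noteq> {}" using x0 by (auto simp: T_def)
  moreover have "T \<inter> S = {}" using le by (fastforce simp: T_def S_def)
  ultimately obtain w b where "w \<noteq> 0" and w: "\<forall>X\<in>T. w \<bullet> X \<le> b" "\<forall>X\<in>S. b \<le> w \<bullet> X"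
    using separating_hyperplane_sets[of T S] by blast
  obtain c \<gamma> where cg: "w = (c, \<gamma>)" by (cases w)
  have wT: "c \<bullet> x + \<gamma> * \<alpha> \<le> b" if "x \<in> A" "\<alpha> \<le> p" for x \<alpha>
    using w(1) that by (auto simp: T_def cg)
  have wS: "b \<le> c \<bullet> x + \<gamma> * \<alpha>" if "f x < \<alpha>" for x \<alpha>
    using w(2) that by (auto simp: S_def cg)
  have "0 \<le> \<gamma> * (f x0 + 1 - p)"
    using wT[OF x0, of p] wS[of x0 "f x0 + 1"] by (simp add: algebra_simps)
  then have "0 \<le> \<gamma>"
    using le[OF x0] by (simp add: zero_le_mult_iff)
  moreover have "\<gamma> \<noteq> 0"
  proof
    \<comment> \<open>A vertical hyperplane would have to keep every point on the upper side, since
      \<open>f\<close> is finite everywhere; the point \<open>x0 - c\<close> violates this unless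
      \<open>c = 0\<close>.\<close>
    assume "\<gamma> = 0"
    then have "c \<bullet> x0 \<le> c \<bullet> (x0 - c)"
      using wT[OF x0, of p] wS[of "x0 - c" "f (x0 - c) + 1"] by simp
    then have "c \<bullet> c \<le> 0" by (simp add: inner_diff_right)
    then have "c = 0" by (simp flip: power2_norm_eq_inner)
    then show False using \<open>w \<noteq> 0\<close> \<open>\<gamma> = 0\<close> by (simp add: cg zero_prod_def)
  qed
  ultimately have "0 < \<gamma>" by simp
  \<comment> \<open>The heights \<open>f x + e / \<gamma>\<close> belong to the strict epigraph; let
    \<open>e\<close> tend to 0.\<close>
  have lower: "b \<le> c \<bullet> x + \<gamma> * f x" for x
  proof (rule field_le_epsilon)
    fix e :: real assume "0 < e"
    then show "b \<le> c \<bullet> x + \<gamma> * f x + e"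
      using wS[of x "f x + e / \<gamma>"] \<open>0 < \<gamma>\<close> by (simp add: algebra_simps)
  qed
  have "h x0 = 0" "g x0 \<le> 0" using x0 A(1) by auto
  moreover have "c \<bullet> x \<le> b - \<gamma> * p" if "h x = 0" "g x \<le> 0" for x
    using wT[of x p] that A(1) by simp
  ultimately obtain \<kappa> \<mu> where mu: "0 \<le> \<mu>"
    and km: "\<And>x. c \<bullet> x - (b - \<gamma> * p) \<le> \<kappa> \<bullet> h x + \<mu> \<bullet> g x"
    using affine_farkas[OF h g] by metis
  show ?thesis
  proof
    show "0 \<le> (1 / \<gamma>) *\<^sub>R \<mu>"
      using mu \<open>0 < \<gamma>\<close> by (auto simp: eucl_le[where 'a = 'm])
    fix x
    have "\<gamma> * p \<le> \<gamma> * f x + \<kappa> \<bullet> h x + \<mu> \<bullet> g x"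
      using lower[of x] km[of x] by linarith
    then show "p \<le> f x + ((1 / \<gamma>) *\<^sub>R \<kappa>) \<bullet> h x + ((1 / \<gamma>) *\<^sub>R \<mu>) \<bullet> g x"
      using \<open>0 < \<gamma>\<close> by (simp add: field_simps)
  qed
qed

section \<open>Strong duality of conic programs\<close>

text \<open>Perturbing the constraint to \<open>G x - y \<in> K\<close> gives a convex set
  \<open>W\<close> of attainable pairs of a perturbation and a strict upper bound on the cost. It
  misses \<open>(0, p)\<close>, and a separating normal \<open>(n, \<gamma>)\<close> yields the
  multiplier \<open>- n / \<gamma>\<close>; the interior point forces
  \<open>\<gamma> > 0\<close>.\<close>

lemma cone_multiplier:
  fixes G :: "'x::real_vector \<Rightarrow> 'y::euclidean_space"
  assumes "convex A" and f: "convex_on A f" and G: "affine_map G" and K: "convex_cone K"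
    and x0: "x0 \<in> A" "G x0 \<in> interior K"
    and le: "\<And>x. x \<in> A \<Longrightarrow> G x \<in> K \<Longrightarrow> p \<le> f x"
  obtains \<nu> where "\<nu> \<in> dual_cone K" "\<And>x. x \<in> A \<Longrightarrow> p \<le> f x - \<nu> \<bullet> G x"
proof -
  define W where "W = {(G x - k, \<alpha>) | x k \<alpha>. x \<in> A \<and> k \<in> K \<and> f x < \<alpha>}"
  have "convex W"
  proof (rule convexI)
    fix X Y and u v :: real
    assume "X \<in> W" "Y \<in> W" and uv: "0 \<le> u" "0 \<le> v" "u + v = 1"
    then obtain x k \<alpha> y l \<beta> where XY: "X = (G x - k, \<alpha>)" "Y = (G y - l, \<beta>)"
      and lt: "f x < \<alpha>" "f y < \<beta>" and in_A: "x \<in> A" "y \<in> A" and in_K: "k \<in> K" "l \<in> K"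
      unfolding W_def by blast
    have "f (u *\<^sub>R x + v *\<^sub>R y) \<le> u * f x + v * f y"
      using f uv in_A by (simp add: convex_on_def)
    also have "\<dots> < u * \<alpha> + v * \<beta>"
    proof (cases "u = 0")
      case True
      then show ?thesis using uv lt by simp
    next
      case False
      then have "u * f x < u * \<alpha>" using lt uv by simp
      moreover have "v * f y \<le> v * \<beta>" using lt uv by (simp add: mult_left_mono)
      ultimately show ?thesis by linarith
    qed
    finally have "f (u *\<^sub>R x + v *\<^sub>R y) < u * \<alpha> + v * \<beta>" .
    moreover have "u *\<^sub>R x + v *\<^sub>R y \<in> A"
      using \<open>convex A\<close> in_A uv by (simp add: convex_def)
    moreover have "u *\<^sub>R k + v *\<^sub>R l \<in> K"
      using K in_K uv by (simp add: convex_cone_iff)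
    moreover have "G (u *\<^sub>R x + v *\<^sub>R y) = u *\<^sub>R G x + v *\<^sub>R G y"
    proof -
      have "u = 1 - v" using uv by simp
      then show ?thesis using G by (simp add: affine_map_def)
    qed
    then have "u *\<^sub>R X + v *\<^sub>R Y
        = (G (u *\<^sub>R x + v *\<^sub>R y) - (u *\<^sub>R k + v *\<^sub>R l), u * \<alpha> + v * \<beta>)"
      by (simp add: XY scaleR_diff_right)
    ultimately show "u *\<^sub>R X + v *\<^sub>R Y \<in> W"
      unfolding W_def by blast
  qed
  moreover have K0: "0 \<in> K" using K by (rule convex_cone_contains_0)
  have "W \<noteq> {}" unfolding W_def using x0 K0 gt_ex[of "f x0"] by blast
  moreover have "{(0, p)} \<inter> W = {}" using le by (fastforce simp: W_def)
  ultimately obtain w b where "w \<noteq> 0" and w: "w \<bullet> (0, p) \<le> b" "\<forall>X\<in>W. b \<le> w \<bullet> X"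
    using separating_hyperplane_sets[of "{(0, p)}" W] by auto
  obtain n \<gamma> where ng: "w = (n, \<gamma>)" by (cases w)
  have wW: "\<gamma> * p \<le> n \<bullet> (G x - k) + \<gamma> * \<alpha>" if "x \<in> A" "k \<in> K" "f x < \<alpha>" for x k \<alpha>
  proof -
    have "(G x - k, \<alpha>) \<in> W" using that by (auto simp: W_def)
    then show ?thesis using w by (force simp: ng)
  qed
  have Gx0: "G x0 \<in> K" using x0 interior_subset by blast
  have "0 \<le> \<gamma> * (f x0 + 1 - p)"
    using wW[OF x0(1) Gx0, of "f x0 + 1"] by (simp add: algebra_simps)
  then have "0 \<le> \<gamma>"
    using le[OF x0(1) Gx0] by (simp add: zero_le_mult_iff)
  moreover have "\<gamma> \<noteq> 0"
  proof
    assume "\<gamma> = 0"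
    then have "n \<noteq> 0" using \<open>w \<noteq> 0\<close> by (auto simp: ng zero_prod_def)
    obtain e where "0 < e" and e: "cball (G x0) e \<subseteq> K"
      using x0(2) by (auto simp: mem_interior_cball)
    \<comment> \<open>With this point of \<open>K\<close> as \<open>k\<close>, the difference
      \<open>G x0 - k\<close> is a negative multiple of \<open>n\<close>, so a vertical hyperplane
      cannot have \<open>W\<close> on its upper side.\<close>
    have "G x0 + (e / norm n) *\<^sub>R n \<in> K"
      using e \<open>0 < e\<close> \<open>n \<noteq> 0\<close> by (auto simp: dist_norm)
    from wW[OF x0(1) this, of "f x0 + 1"] have "(e / norm n) * (n \<bullet> n) \<le> 0"
      using \<open>\<gamma> = 0\<close> by simp
    then show False
      using \<open>0 < e\<close> \<open>n \<noteq> 0\<close> by (simp add: mult_le_0_iff divide_le_0_iff flip: power2_norm_eq_inner)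
  qed
  ultimately have "0 < \<gamma>" by simp
  have lower: "\<gamma> * p \<le> n \<bullet> (G x - k) + \<gamma> * f x" if "x \<in> A" "k \<in> K" for x k
  proof (rule field_le_epsilon)
    fix e :: real assume "0 < e"
    then show "\<gamma> * p \<le> n \<bullet> (G x - k) + \<gamma> * f x + e"
      using wW[OF that, of "f x + e / \<gamma>"] \<open>0 < \<gamma>\<close> by (simp add: algebra_simps)
  qed
  have nK: "n \<bullet> k \<le> 0" if "k \<in> K" for k
  proof (rule ccontr)
    assume "\<not> n \<bullet> k \<le> 0"
    \<comment> \<open>\<open>r\<close> is the slack of \<open>lower\<close> at \<open>x0\<close> for
      \<open>k = 0\<close>; a multiple of \<open>k\<close> with inner product \<open>r + 1\<close>
      would exceed it.\<close>
    define r where "r = n \<bullet> G x0 + \<gamma> * f x0 - \<gamma> * p"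
    have "0 \<le> r" using lower[OF x0(1) K0] by (simp add: r_def)
    then have "((r + 1) / (n \<bullet> k)) *\<^sub>R k \<in> K"
      using K that \<open>\<not> n \<bullet> k \<le> 0\<close> by (intro convex_cone_scaleR) auto
    from lower[OF x0(1) this] show False
      using \<open>\<not> n \<bullet> k \<le> 0\<close> by (simp add: r_def inner_diff_right)
  qed
  show ?thesis
  proof
    show "(- 1 / \<gamma>) *\<^sub>R n \<in> dual_cone K"
      using nK \<open>0 < \<gamma>\<close> by (auto simp: dual_cone_def inner_commute divide_nonpos_pos)
    show "p \<le> f x - ((- 1 / \<gamma>) *\<^sub>R n) \<bullet> G x" if "x \<in> A" for x
      using lower[OF that K0] \<open>0 < \<gamma>\<close> by (simp add: field_simps)
  qed
qed

section \<open>The rotated second-order cone\<close>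

text \<open>For sums, the mixed term \<open>2 * (norm c * norm c')\<close> is bounded by
  \<open>a * b' + a' * b\<close>: the square of the latter is at least
  \<open>4 * (a * b) * (a' * b')\<close>, by the inequality of arithmetic and geometric
  means.\<close>

lemma convex_cone_rotated_cone:
  "convex_cone (rotated_cone :: (real \<times> real \<times> 'c::real_inner) set)"
  unfolding convex_cone_iff
proof (intro conjI ballI allI impI)
  show "(0 :: real \<times> real \<times> 'c) \<in> rotated_cone"
    by (simp add: rotated_cone_def zero_prod_def)
next
  fix X Y :: "real \<times> real \<times> 'c"
  assume "X \<in> rotated_cone" "Y \<in> rotated_cone"
  then obtain a b c a' b' c' where XY: "X = (a, b, c)" "Y = (a', b', c')"
    and nn: "0 \<le> a" "0 \<le> b" "0 \<le> a'" "0 \<le> b'"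
    and c: "(norm c)\<^sup>2 \<le> a * b" "(norm c')\<^sup>2 \<le> a' * b'"
    unfolding rotated_cone_def by blast
  have "2 * (norm c * norm c') \<le> a * b' + a' * b"
  proof (rule power2_le_imp_le)
    have "(norm c)\<^sup>2 * (norm c')\<^sup>2 \<le> (a * b) * (a' * b')"
      using c nn by (intro mult_mono) auto
    moreover have "0 \<le> (a * b' - a' * b)\<^sup>2" by simp
    ultimately show "(2 * (norm c * norm c'))\<^sup>2 \<le> (a * b' + a' * b)\<^sup>2"
      by (simp add: power2_eq_square algebra_simps)
  qed (use nn in simp)
  moreover have "(norm (c + c'))\<^sup>2 \<le> (norm c + norm c')\<^sup>2"
    by (intro power_mono norm_triangle_ineq norm_ge_zero)
  ultimately show "X + Y \<in> rotated_cone"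
    using nn c by (simp add: XY rotated_cone_def power2_eq_square algebra_simps)
next
  fix X :: "real \<times> real \<times> 'c" and t :: real
  assume "X \<in> rotated_cone" "0 \<le> t"
  moreover have "(t * norm c)\<^sup>2 \<le> (t * a) * (t * b)" if "(norm c)\<^sup>2 \<le> a * b" for a b and c :: 'c
    using mult_left_mono[OF that, of "t\<^sup>2"] by (simp add: power2_eq_square ac_simps)
  ultimately show "t *\<^sub>R X \<in> rotated_cone"
    by (auto simp: rotated_cone_def)
qed

text \<open>Strictness of the quadratic inequality already forces \<open>a\<close> and
  \<open>b\<close> to be positive, so every component lies in an open subset \<open>U\<close> of the
  cone.\<close>

lemma rotated_cone_power_interior:
  fixes y :: "(real \<times> real \<times> 'c::real_inner)^'k"
  assumes "\<And>k. y $ k \<in> rotated_cone"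
    and "\<And>k. case y $ k of (a, b, c) \<Rightarrow> a * b > (norm c)\<^sup>2"
  shows "y \<in> interior {y. \<forall>k. y $ k \<in> rotated_cone}"
proof (rule interiorI)
  define U :: "(real \<times> real \<times> 'c) set"
    where "U = {X. 0 < fst X \<and> 0 < fst (snd X) \<and> (norm (snd (snd X)))\<^sup>2 < fst X * fst (snd X)}"
  have "open U"
    unfolding U_def by (intro open_Collect_conj open_Collect_less continuous_intros)
  then show "open {y :: (real \<times> real \<times> 'c)^'k. \<forall>k. y $ k \<in> U}"
    by (simp add: open_vector_box)
  have "U \<subseteq> rotated_cone"
    by (auto simp: U_def rotated_cone_def)
  have "y $ k \<in> U" for k
  proof -
    obtain a b c where abc: "y $ k = (a, b, c)" by (metis surj_pair)
    have "0 \<le> a" "0 \<le> b" "(norm c)\<^sup>2 < a * b"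
      using assms[of k] by (auto simp: abc rotated_cone_def)
    moreover from this have "0 < a * b" by (meson le_less_trans zero_le_power2)
    ultimately show ?thesis by (auto simp: U_def abc zero_less_mult_iff)
  qed
  then show "y \<in> {y. \<forall>k. y $ k \<in> U}" by simp
  show "{y. \<forall>k. y $ k \<in> U} \<subseteq> {y. \<forall>k. y $ k \<in> rotated_cone}"
    using \<open>U \<subseteq> rotated_cone\<close> by blast
qed

section \<open>Weak and strong duality\<close>

text \<open>At a feasible point every multiplier term of the Lagrangian is at most zero.\<close>

lemma dual_value_le_primal_value:
  fixes P :: "('x, 'e::real_inner, 'm::ordered_euclidean_space, 'c::real_inner, 'k::finite) program"
  shows "dual_value P \<le> primal_value P"
  unfolding dual_value_def primal_value_def
proof (intro SUP_least INF_greatest, clarify)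
  fix \<kappa> :: 'e and \<mu> :: 'm and \<nu> :: "(real \<times> real \<times> 'c)^'k" and x
  assume mu: "0 \<le> \<mu>" and nu: "\<forall>k. \<nu> $ k \<in> dual_cone rotated_cone" and "feasible P x"
  then have x: "eq_map P x = 0" "ineq_map P x \<le> 0" "\<And>k. cone_map P x $ k \<in> rotated_cone"
    by (auto simp: feasible_def)
  have "\<mu> \<bullet> ineq_map P x \<le> 0"
    using inner_nonneg_nonneg[OF mu, of "- ineq_map P x"] x(2) by (auto simp: eucl_le[where 'a = 'm])
  moreover have "0 \<le> (\<Sum>k\<in>UNIV. \<nu> $ k \<bullet> cone_map P x $ k)"
    using nu x(3) by (intro sum_nonneg) (subst inner_commute, simp add: dual_cone_def)
  ultimately have "lagrangian P \<kappa> \<mu> \<nu> x \<le> objective P x"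
    by (simp add: lagrangian_def x(1))
  then show "(INF x. ereal (lagrangian P \<kappa> \<mu> \<nu> x)) \<le> ereal (objective P x)"
    by (intro INF_lower2[of x]) auto
qed

text \<open>The conic multiplier \<nu> is found first, with the affine constraints kept as the
  domain \<open>A\<close>. The penalised objective is still convex on the whole space, so the affine
  constraints can be dualised afterwards. The resulting multipliers attain the dual value.\<close>

theorem slater_strong_duality:
  fixes P :: "('x::euclidean_space, 'e::euclidean_space, 'm::ordered_euclidean_space,
    'c::euclidean_space, 'k::finite) program"
  assumes f: "convex_on UNIV (objective P)" "bdd_below (range (objective P))"
    and h: "affine_map (eq_map P)" and g: "affine_map (ineq_map P)" and G: "affine_map (cone_map P)"
    and slater: "strictly_feasible P"
  shows "strong_duality P"
proof -
  define A where "A = {x. eq_map P x = 0 \<and> ineq_map P x \<le> 0}"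
  define K :: "((real \<times> real \<times> 'c)^'k) set" where "K = {y. \<forall>k. y $ k \<in> rotated_cone}"
  \<comment> \<open>The lower bound on the objective and the Slater point make this infimum a real
    number.\<close>
  define p where "p = Inf (objective P ` {x. feasible P x})"
  have feasible_iff: "feasible P x \<longleftrightarrow> x \<in> A \<and> cone_map P x \<in> K" for x
    by (auto simp: feasible_def A_def K_def)
  obtain x0 where x0: "feasible P x0"
    and strict: "\<And>k. case cone_map P x0 $ k of (a, b, c) \<Rightarrow> a * b > (norm c)\<^sup>2"
    using slater by (auto simp: strictly_feasible_def)
  have bdd: "bdd_below (objective P ` {x. feasible P x})"
    using f(2) by (rule bdd_below_mono) auto
  have ne: "objective P ` {x. feasible P x} \<noteq> {}" using x0 by blast
  have primal: "primal_value P = ereal p"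
    unfolding primal_value_def p_def
    using ereal_Inf'[OF bdd ne] by (simp add: image_image)
  have "convex A"
  proof (rule convexI)
    fix x y and u v :: real
    assume xy: "x \<in> A" "y \<in> A" and uv: "0 \<le> u" "0 \<le> v" "u + v = 1"
    then have u: "u = 1 - v" by simp
    have "ineq_map P (u *\<^sub>R x + v *\<^sub>R y) = u *\<^sub>R ineq_map P x + v *\<^sub>R ineq_map P y"
      using g by (simp add: affine_map_def u)
    also have "\<dots> \<le> 0"
      using xy uv by (auto simp: A_def eucl_le[where 'a = 'm] inner_add_left
          intro!: add_nonpos_nonpos mult_nonneg_nonpos)
    finally show "u *\<^sub>R x + v *\<^sub>R y \<in> A"
      using h xy by (simp add: A_def affine_map_def u)
  qed
  have "convex_cone K"
    using convex_cone_rotated_cone[where 'c = 'c] by (simp add: K_def convex_cone_iff)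
  obtain \<nu> where nu: "\<nu> \<in> dual_cone K"
    and p_le: "\<And>x. x \<in> A \<Longrightarrow> p \<le> objective P x - \<nu> \<bullet> cone_map P x"
  proof (rule cone_multiplier[OF \<open>convex A\<close> _ G \<open>convex_cone K\<close>])
    show "convex_on A (objective P)"
      using f(1) by (rule convex_on_subset) (auto simp: \<open>convex A\<close>)
    show "x0 \<in> A" using x0 by (simp add: feasible_iff)
    show "cone_map P x0 \<in> interior K"
      unfolding K_def
      by (rule rotated_cone_power_interior[OF _ strict]) (use x0 in \<open>simp add: feasible_def\<close>)
    show "p \<le> objective P x" if "x \<in> A" "cone_map P x \<in> K" for x
      unfolding p_def using that by (intro cInf_lower[OF _ bdd]) (auto simp: feasible_iff)
  qed blast
  have convex_penalised: "convex_on UNIV (\<lambda>x. objective P x - \<nu> \<bullet> cone_map P x)"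
  proof (rule convex_onI)
    fix t :: real and x y
    assume "0 < t" "t < 1"
    then show "objective P ((1 - t) *\<^sub>R x + t *\<^sub>R y) - \<nu> \<bullet> cone_map P ((1 - t) *\<^sub>R x + t *\<^sub>R y)
      \<le> (1 - t) * (objective P x - \<nu> \<bullet> cone_map P x) + t * (objective P y - \<nu> \<bullet> cone_map P y)"
      using convex_onD[OF f(1), of t x y] G
      by (simp add: affine_map_def inner_add_right right_diff_distrib)
  qed simp
  obtain \<kappa> \<mu> where mu: "0 \<le> \<mu>"
    and km: "\<And>x. p \<le> objective P x - \<nu> \<bullet> cone_map P x + \<kappa> \<bullet> eq_map P x + \<mu> \<bullet> ineq_map P x"
    using affine_multipliers[OF convex_penalised h g A_def \<open>convex A\<close> _ p_le] x0
    by (metis feasible_iff)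
  have "ereal p \<le> (INF x. ereal (lagrangian P \<kappa> \<mu> \<nu> x))"
    using km by (intro INF_greatest) (simp add: lagrangian_def inner_vec_def algebra_simps)
  moreover have "\<nu> $ k \<in> dual_cone rotated_cone" for k
    unfolding dual_cone_def
  proof (intro CollectI ballI)
    fix X :: "real \<times> real \<times> 'c" assume "X \<in> rotated_cone"
    \<comment> \<open>Vectors supported on a single component test each component of \<nu>
      separately.\<close>
    then have "axis k X \<in> K"
      using convex_cone_contains_0[OF convex_cone_rotated_cone[where 'c = 'c]]
      by (simp add: K_def axis_def)
    then show "0 \<le> X \<bullet> \<nu> $ k"
      using nu by (auto simp: dual_cone_def inner_axis')
  qed
  ultimately have "ereal p \<le> dual_value P"
    unfolding dual_value_def using mu by (intro SUP_upper2[of "(\<kappa>, \<mu>, \<nu>)"]) auto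
  then show ?thesis
    using dual_value_le_primal_value[of P] by (simp add: strong_duality_def primal)
qed

section \<open>Strict feasibility\<close>

text \<open>Induction along the path to the root: the root has no outgoing branch, and any other
  node has only the one to its parent.\<close>

lemma wf_converse_branches:
  assumes "rooted_tree D"
  shows "wf ((branches D)\<inverse>)"
proof (rule acc_wfI, rule allI)
  fix a
  have "(a, None) \<in> (branches D)\<^sup>*" using assms by (simp add: rooted_tree_def)
  then show "a \<in> Wellfounded.acc ((branches D)\<inverse>)"
  proof (induction rule: converse_rtrancl_induct)
    case base
    show ?case by (rule accI) (auto simp: branches_def)
  next
    case (step a b)
    show ?case
    proof (rule accI)
      fix y assume "(y, a) \<in> (branches D)\<inverse>"
      then have "y = b" using step(1) by (auto simp: branches_def)
      then show "y \<in> Wellfounded.acc ((branches D)\<inverse>)" using step(3) by simp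
    qed
  qed
qed

text \<open>This orientation allows recursion from the leaves towards the root. The opposite one
  supplies acyclicity, which suffices on a finite tree.\<close>

lemma wf_branches:
  fixes D :: "('n::finite) opf_data"
  assumes "rooted_tree D"
  shows "wf (branches D)"
proof (rule finite_acyclic_wf)
  show "acyclic (branches D)"
    using wf_acyclic[OF wf_converse_branches[OF assms]] by simp
qed simp

lemma path_branches_unfold:
  "path_branches D i =
    insert i (case parent D i of None \<Rightarrow> {} | Some j \<Rightarrow> path_branches D j)"
proof (intro set_eqI iffI)
  fix m assume "m \<in> path_branches D i"
  then have "(Some i, Some m) \<in> (branches D)\<^sup>*" by (simp add: path_branches_def)
  then show "m \<in> insert i (case parent D i of None \<Rightarrow> {} | Some j \<Rightarrow> path_branches D j)"
  proof (cases rule: converse_rtranclE)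
    case (step b)
    then have "b = parent D i" by (auto simp: branches_def)
    \<comment> \<open>No branch leaves the root, so a path that has reached it cannot end in
      \<open>Some m\<close>.\<close>
    moreover have "b \<noteq> None"
      using step(2) by (auto elim: converse_rtranclE simp: branches_def)
    ultimately show ?thesis using step by (auto simp: path_branches_def)
  qed simp
next
  fix m assume m: "m \<in> insert i (case parent D i of None \<Rightarrow> {} | Some j \<Rightarrow> path_branches D j)"
  have "(Some i, parent D i) \<in> branches D" by (auto simp: branches_def)
  with m show "m \<in> path_branches D i"
    by (auto simp: path_branches_def split: option.splits intro: converse_rtrancl_into_rtrancl)
qed

text \<open>Acyclicity keeps \<open>i\<close> off the path of its parent, so its own term splits off
  from the sum.\<close>

lemma path_sum_unfold:
  fixes D :: "('n::finite) opf_data"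
  assumes "rooted_tree D"
  shows "path_sum D \<tau> \<beta> i =
    \<tau> $ i - 2 * \<beta> $ i + (case parent D i of None \<Rightarrow> 0 | Some j \<Rightarrow> path_sum D \<tau> \<beta> j)"
proof (cases "parent D i")
  case None
  then show ?thesis by (simp add: path_sum_def path_branches_unfold[of D i])
next
  case (Some j)
  have "i \<notin> path_branches D j"
  proof
    assume "i \<in> path_branches D j"
    then have "(Some j, Some i) \<in> (branches D)\<^sup>*" by (simp add: path_branches_def)
    moreover have "(Some i, Some j) \<in> branches D" using Some by (auto simp: branches_def)
    ultimately have "(Some i, Some i) \<in> (branches D)\<^sup>+" by (rule rtrancl_into_trancl2[rotated])
    then show False using wf_acyclic[OF wf_branches[OF assms]] by (simp add: acyclic_def)
  qed
  then show ?thesis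
    using Some by (simp add: path_sum_def path_branches_unfold[of D i])
qed

section \<open>From OPF-SOCP1 to OPF-Cr\<close>

text \<open>On each branch the power \<open>S - z l\<close> delivered to the upper end is
  \<open>- z \<beta> / \<bar>z\<bar>\<^sup>2\<close>, which gives the power balances. The voltage
  difference is \<open>\<tau> - 2 * \<beta>\<close>, the increment of the path sum.\<close>

lemma cr_eq_socp1_point:
  fixes D :: "('n::finite) opf_data"
  assumes tree: "rooted_tree D" and z: "\<And>i. imp D i \<noteq> 0"
  shows "cr_eq D (socp1_point D (\<tau>, \<beta>)) = 0"
proof -
  have zsq: "zsq D i \<noteq> 0" for i using z by (simp add: zsq_def)
  have branch: "imp D k * of_real (\<tau> $ k - \<beta> $ k) / of_real (zsq D k)
      - imp D k * of_real (\<tau> $ k / zsq D k)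
      = - (imp D k / of_real (zsq D k) * of_real (\<beta> $ k))" for k
    by (simp add: field_simps diff_divide_distrib)
  have drop: "2 * Re (cnj (imp D i) * (imp D i * of_real (\<tau> $ i - \<beta> $ i) / of_real (zsq D i)))
      - zsq D i * (\<tau> $ i / zsq D i) = \<tau> $ i - 2 * \<beta> $ i" for i
  proof -
    have "cnj (imp D i) * (imp D i * of_real (\<tau> $ i - \<beta> $ i) / of_real (zsq D i))
      = (imp D i * cnj (imp D i)) * of_real (\<tau> $ i - \<beta> $ i) / of_real (zsq D i)"
      by simp
    also have "\<dots> = of_real (\<tau> $ i - \<beta> $ i)"
      using zsq[of i] by (simp add: zsq_def flip: complex_norm_square)
    finally have "cnj (imp D i) * (imp D i * of_real (\<tau> $ i - \<beta> $ i) / of_real (zsq D i))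
      = of_real (\<tau> $ i - \<beta> $ i)" .
    then show ?thesis using zsq[of i] by simp
  qed
  show ?thesis
    unfolding socp1_point.simps cr_eq.simps zero_prod_def prod.inject vec_eq_iff vec_lambda_beta
      zero_index drop volt_def branch
    by (auto simp: sum_negf path_sum_unfold[OF tree, of \<tau> \<beta>] split: option.split)
qed

lemma cr_ineq_socp1_point:
  fixes D :: "('n::finite) opf_data"
  assumes z: "\<And>i. imp D i \<noteq> 0" and "socp1_ineq D (\<tau>, \<beta>) \<le> 0"
  shows "cr_ineq D (socp1_point D (\<tau>, \<beta>)) \<le> 0"
proof -
  have zsq: "0 < zsq D i" for i using z by (simp add: zsq_def)
  have Re: "Re (imp D i / of_real (zsq D i) * of_real (\<tau> $ i - \<beta> $ i)
      + (\<Sum>k\<in>children D (Some i). imp D k / of_real (zsq D k) * of_real (\<beta> $ k)))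
      = socp1_p D \<tau> \<beta> i" for i
    by (simp add: socp1_p_def res_def)
  have Im: "Im (imp D i / of_real (zsq D i) * of_real (\<tau> $ i - \<beta> $ i)
      + (\<Sum>k\<in>children D (Some i). imp D k / of_real (zsq D k) * of_real (\<beta> $ k)))
      = socp1_q D \<tau> \<beta> i" for i
    by (simp add: socp1_q_def rea_def)
  show ?thesis
    using assms(2) zsq
    unfolding socp1_point.simps cr_ineq.simps socp1_ineq.simps zero_prod_def Pair_le
      less_eq_vec_def vec_lambda_beta zero_index option.case Re Im
    by (auto simp: field_simps)
qed

lemma norm_socp1_point_power:
  fixes D :: "('n::finite) opf_data"
  assumes "imp D i \<noteq> 0"
  shows "(cmod (imp D i * of_real t / of_real (zsq D i)))\<^sup>2 = t\<^sup>2 / zsq D i"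
  using assms
  by (simp add: zsq_def norm_mult norm_divide norm_power power_mult_distrib power_divide
      power2_eq_square)

text \<open>Under the parametrisation the conic inequality of OPF-Cr is that of OPF-SOCP1 divided by
  \<open>zsq D i\<close>, so strictness is preserved.\<close>

lemma strictly_feasible_Cr_if_SOCP1:
  fixes D :: "('n::finite) opf_data"
  assumes tree: "rooted_tree D" and z: "\<And>i. imp D i \<noteq> 0"
    and "strictly_feasible (OPF_SOCP1 D)"
  shows "strictly_feasible (OPF_Cr D)"
proof -
  have zsq: "0 < zsq D i" for i using z by (simp add: zsq_def)
  obtain \<tau> \<beta> where feas: "feasible (OPF_SOCP1 D) (\<tau>, \<beta>)"
    and strict: "\<And>i. (vref D + path_sum D \<tau> \<beta> i) * \<tau> $ i > (\<tau> $ i - \<beta> $ i)\<^sup>2"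
    using assms(3) by (auto simp: strictly_feasible_def OPF_SOCP1_def)
  have ineq: "socp1_ineq D (\<tau>, \<beta>) \<le> 0"
    and nn: "\<And>i. 0 \<le> vref D + path_sum D \<tau> \<beta> i" "\<And>i. 0 \<le> \<tau> $ i"
    using feas by (auto simp: feasible_def OPF_SOCP1_def rotated_cone_def)
  let ?x = "socp1_point D (\<tau>, \<beta>)"
  have cone: "cr_cone D ?x $ i = (vref D + path_sum D \<tau> \<beta> i, \<tau> $ i / zsq D i,
      imp D i * of_real (\<tau> $ i - \<beta> $ i) / of_real (zsq D i))" for i
    by simp
  have lt: "(cmod (imp D i * of_real (\<tau> $ i - \<beta> $ i) / of_real (zsq D i)))\<^sup>2
      < (vref D + path_sum D \<tau> \<beta> i) * (\<tau> $ i / zsq D i)" for i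
    unfolding norm_socp1_point_power[OF z]
    using strict[of i] zsq[of i] by (simp add: divide_strict_right_mono)
  have "feasible (OPF_Cr D) ?x"
    unfolding feasible_def OPF_Cr_def conic_program.simps cone
    using cr_eq_socp1_point[OF tree z] cr_ineq_socp1_point[OF z ineq] nn zsq lt
    by (simp add: rotated_cone_def less_imp_le)
  then show ?thesis
    unfolding strictly_feasible_def OPF_Cr_def
    by (intro exI[of _ ?x] conjI) (simp, use lt cone in \<open>simp del: cr_cone.simps socp1_point.simps\<close>)
qed

section \<open>Small multiples of a direction\<close>

text \<open>The sign condition that puts \<open>\<epsilon> * s\<close> between \<open>m\<close> and
  \<open>M\<close> for all small positive \<epsilon>: the sign of \<open>s\<close> is restricted
  only where a bound is zero.\<close>

definition admissible_direction :: "real \<Rightarrow> real \<Rightarrow> real \<Rightarrow> bool" where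
  "admissible_direction m s M \<longleftrightarrow> (m < 0 \<or> m \<le> 0 \<and> 0 \<le> s) \<and> (0 < M \<or> 0 \<le> M \<and> s \<le> 0)"

lemma admissible_directionD:
  assumes "admissible_direction m s M"
  shows "\<forall>\<^sub>F \<epsilon> in at_right 0. m \<le> \<epsilon> * s \<and> \<epsilon> * s \<le> M"
proof -
  have lim: "((\<lambda>\<epsilon>. \<epsilon> * s) \<longlongrightarrow> 0) (at_right 0)"
    by (auto intro!: tendsto_eq_intros)
  have pos: "\<forall>\<^sub>F \<epsilon> in at_right 0. (0::real) < \<epsilon>"
    by (simp add: eventually_at_right_less)
  have "\<forall>\<^sub>F \<epsilon> in at_right 0. m \<le> \<epsilon> * s"
  proof (cases "m < 0")
    case True
    from order_tendstoD(1)[OF lim this] show ?thesis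
      by (rule eventually_mono) simp
  next
    case False
    then have "m \<le> 0" "0 \<le> s" using assms by (auto simp: admissible_direction_def)
    then show ?thesis
      by (intro eventually_mono[OF pos]) (metis mult_nonneg_nonneg less_imp_le order_trans)
  qed
  moreover have "\<forall>\<^sub>F \<epsilon> in at_right 0. \<epsilon> * s \<le> M"
  proof (cases "0 < M")
    case True
    from order_tendstoD(2)[OF lim this] show ?thesis
      by (rule eventually_mono) simp
  next
    case False
    then have "0 \<le> M" "s \<le> 0" using assms by (auto simp: admissible_direction_def)
    then show ?thesis
      by (intro eventually_mono[OF pos]) (metis mult_nonneg_nonpos less_imp_le order_trans)
  qed
  ultimately show ?thesis by (rule eventually_conj)
qed

lemma path_sum_scaleR: "path_sum D (c *\<^sub>R \<tau>) (c *\<^sub>R \<beta>) i = c * path_sum D \<tau> \<beta> i"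
  by (simp add: path_sum_def sum_distrib_left algebra_simps)

lemma socp1_p_scaleR: "socp1_p D (c *\<^sub>R \<tau>) (c *\<^sub>R \<beta>) i = c * socp1_p D \<tau> \<beta> i"
  by (simp add: socp1_p_def sum_distrib_left distrib_left mult.left_commute
      flip: right_diff_distrib)

lemma socp1_q_scaleR: "socp1_q D (c *\<^sub>R \<tau>) (c *\<^sub>R \<beta>) i = c * socp1_q D \<tau> \<beta> i"
  by (simp add: socp1_q_def sum_distrib_left distrib_left mult.left_commute
      flip: right_diff_distrib)

lemma strictly_feasible_SOCP1_if_direction:
  fixes D :: "('n::finite) opf_data"
  assumes lmax: "\<And>i. lmax D i > 0" and z: "\<And>i. imp D i \<noteq> 0"
    and v: "\<And>i. vmax D i > vref D \<and> vref D > vmin D i \<and> vmin D i > 0"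
    and p: "\<And>i. admissible_direction (pmin D i) (socp1_p D 1 \<beta> i) (pmax D i)"
    and q: "\<And>i. admissible_direction (qmin D i) (socp1_q D 1 \<beta> i) (qmax D i)"
  shows "strictly_feasible (OPF_SOCP1 D)"
proof -
  have zsq: "0 < zsq D i" for i using z by (simp add: zsq_def)
  have pos: "\<forall>\<^sub>F \<epsilon> in at_right 0. (0::real) < \<epsilon>"
    by (simp add: eventually_at_right_less)
  have "0 < vref D" using v[of undefined] by linarith
  define good where "good \<epsilon> i \<longleftrightarrow>
    0 < \<epsilon> \<and> \<epsilon> \<le> zsq D i * lmax D i \<and>
    (\<epsilon> * (1 - \<beta> $ i))\<^sup>2 < (vref D + \<epsilon> * path_sum D 1 \<beta> i) * \<epsilon> \<and>
    vmin D i - vref D \<le> \<epsilon> * path_sum D 1 \<beta> i \<and> \<epsilon> * path_sum D 1 \<beta> i \<le> vmax D i - vref D \<and>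
    pmin D i \<le> \<epsilon> * socp1_p D 1 \<beta> i \<and> \<epsilon> * socp1_p D 1 \<beta> i \<le> pmax D i \<and>
    qmin D i \<le> \<epsilon> * socp1_q D 1 \<beta> i \<and> \<epsilon> * socp1_q D 1 \<beta> i \<le> qmax D i" for \<epsilon> i
  have "\<forall>\<^sub>F \<epsilon> in at_right 0. good \<epsilon> i" for i
  proof -
    have "\<forall>\<^sub>F \<epsilon> in at_right 0. \<epsilon> < zsq D i * lmax D i"
      using zsq[of i] lmax[of i] by (intro order_tendstoD(2)[OF tendsto_ident_at]) auto
    \<comment> \<open>The conic inequality after division by \<epsilon>, with the path sum moved to
      the left.\<close>
    moreover have "\<forall>\<^sub>F \<epsilon> in at_right 0.
        \<epsilon> * ((1 - \<beta> $ i)\<^sup>2 - path_sum D 1 \<beta> i) < vref D"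
      by (rule order_tendstoD(2)[OF tendsto_mult_left_zero[OF tendsto_ident_at] \<open>0 < vref D\<close>])
    \<comment> \<open>Both voltage bounds are strict at \<open>vref D\<close>, so any value of the
      path sum is admissible.\<close>
    moreover have "\<forall>\<^sub>F \<epsilon> in at_right 0. vmin D i - vref D \<le> \<epsilon> * path_sum D 1 \<beta> i
        \<and> \<epsilon> * path_sum D 1 \<beta> i \<le> vmax D i - vref D"
      using v[of i] by (intro admissible_directionD) (auto simp: admissible_direction_def)
    ultimately show ?thesis
      using admissible_directionD[OF p[of i]] admissible_directionD[OF q[of i]] pos
    proof eventually_elim
      case (elim \<epsilon>)
      have "\<epsilon> * (\<epsilon> * (1 - \<beta> $ i)\<^sup>2) < \<epsilon> * (vref D + \<epsilon> * path_sum D 1 \<beta> i)"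
        using elim by (intro mult_strict_left_mono) (auto simp: right_diff_distrib)
      then show ?case
        using elim by (simp add: good_def power_mult_distrib power2_eq_square ac_simps)
    qed
  qed
  \<comment> \<open>One \<epsilon> serves all nodes because there are finitely many.\<close>
  then have "\<forall>\<^sub>F \<epsilon> in at_right 0. \<forall>i. good \<epsilon> i" by (rule eventually_all_finite)
  then obtain \<epsilon> where good: "\<And>i. good \<epsilon> i"
    using eventually_happens'[OF trivial_limit_at_right_real] by blast
  have vmin: "0 \<le> vmin D i" for i using v[of i] by simp
  have strict: "(\<epsilon> - \<epsilon> * \<beta> $ i)\<^sup>2 < (vref D + \<epsilon> * path_sum D 1 \<beta> i) * \<epsilon>" for i
    using good[of i] by (simp add: good_def right_diff_distrib)
  let ?x = "(\<epsilon> *\<^sub>R 1, \<epsilon> *\<^sub>R \<beta>)"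
  have "feasible (OPF_SOCP1 D) ?x"
    unfolding SOCP1_feasible_iff[OF vmin] path_sum_scaleR socp1_p_scaleR socp1_q_scaleR
    using good strict unfolding good_def by (simp add: less_imp_le)
  moreover have "case cone_map (OPF_SOCP1 D) ?x $ i of (a, b, c) \<Rightarrow> (norm c)\<^sup>2 < a * b" for i
    using strict[of i] by (simp add: OPF_SOCP1_def path_sum_scaleR)
  ultimately show ?thesis unfolding strictly_feasible_def by blast
qed

text \<open>Here \<open>\<tau> = 1\<close>, and \<open>u\<close> stands for \<open>\<tau> $ i - \<beta> $ i\<close>, that is, \<open>1 - \<beta> i\<close>.\<close>

definition direction_at :: "('n::finite) opf_data \<Rightarrow> ('n \<Rightarrow> real) \<Rightarrow> 'n \<Rightarrow> real \<Rightarrow> bool" where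
  "direction_at D \<beta> i u \<longleftrightarrow>
     admissible_direction (pmin D i)
       (res D i / zsq D i * u + (\<Sum>k\<in>children D (Some i). res D k / zsq D k * \<beta> k)) (pmax D i) \<and>
     admissible_direction (qmin D i)
       (rea D i / zsq D i * u + (\<Sum>k\<in>children D (Some i). rea D k / zsq D k * \<beta> k)) (qmax D i)"

section \<open>Choice of the direction from the leaves to the root\<close>

text \<open>\<open>Q\<close> is the invariant handed from the children to their parent. As
  \<open>direction_at D \<beta> i u\<close> depends on \<beta> only at the children of
  \<open>i\<close>, well-founded recursion along the branches fixes the values one node at a
  time.\<close>

lemma direction_exists:
  fixes D :: "('n::finite) opf_data"
  assumes tree: "rooted_tree D"
    and node: "\<And>i \<beta>. (\<And>k. k \<in> children D (Some i) \<Longrightarrow> Q (\<beta> k)) \<Longrightarrow>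
      \<exists>u. Q (1 - u) \<and> direction_at D \<beta> i u"
  shows "\<exists>\<beta>. \<forall>i. direction_at D \<beta> i (1 - \<beta> i)"
proof -
  have "\<exists>\<beta>. \<forall>i. Q (\<beta> i) \<and> direction_at D \<beta> i (1 - \<beta> i)"
  proof (rule dependent_wf_choice[where P = "\<lambda>\<beta> i c. Q c \<and> direction_at D \<beta> i (1 - c)"])
    show "wf (inv_image (branches D) Some)"
      using wf_branches[OF tree] by (rule wf_inv_image)
  next
    fix \<beta> \<beta>' :: "'n \<Rightarrow> real" and i c
    assume "\<And>k. (k, i) \<in> inv_image (branches D) Some \<Longrightarrow> \<beta> k = \<beta>' k"
    then have "\<beta> k = \<beta>' k" if "k \<in> children D (Some i)" for k
      using that by (simp add: children_def)
    then show "(Q c \<and> direction_at D \<beta> i (1 - c)) = (Q c \<and> direction_at D \<beta>' i (1 - c))"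
      by (simp add: direction_at_def)
  next
    fix i and \<beta> :: "'n \<Rightarrow> real"
    assume *: "\<And>k. (k, i) \<in> inv_image (branches D) Some \<Longrightarrow>
      Q (\<beta> k) \<and> direction_at D \<beta> k (1 - \<beta> k)"
    have "Q (\<beta> k)" if "k \<in> children D (Some i)" for k
      using * that by (simp add: children_def)
    from node[of i \<beta>, OF this] obtain u where "Q (1 - u) \<and> direction_at D \<beta> i u" by blast
    then show "\<exists>c. Q c \<and> direction_at D \<beta> i (1 - c)" by (intro exI[of _ "1 - u"]) simp
  qed
  then show ?thesis by blast
qed

text \<open>Both powers increase with \<open>u\<close> and vanish at \<open>s\<close> and
  \<open>t\<close> respectively. In the first two cases the power whose bounds may be zero is
  cancelled, and the strict bounds leave the other one free. In the last two, the smaller or the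
  larger of the two zeros gives both powers a permitted sign.\<close>

lemma admissible_pair:
  fixes a b A B :: real
  assumes "0 < a" "0 < b"
    and "(pm \<le> 0 \<and> 0 \<le> pM \<and> qm < 0 \<and> 0 < qM) \<or> (pm < 0 \<and> 0 < pM \<and> qm \<le> 0 \<and> 0 \<le> qM)
      \<or> (pm < 0 \<and> 0 \<le> pM \<and> qm < 0 \<and> 0 \<le> qM) \<or> (pm \<le> 0 \<and> 0 < pM \<and> qm \<le> 0 \<and> 0 < qM)"
  shows "\<exists>u. admissible_direction pm (a * u + A) pM \<and> admissible_direction qm (b * u + B) qM"
proof -
  define s t where "s = - A / a" and "t = - B / b"
  have p: "a * s + A = 0" and q: "b * t + B = 0"
    using assms(1,2) by (simp_all add: s_def t_def)
  have mono: "a * u + A \<le> a * u' + A" "b * u + B \<le> b * u' + B" if "u \<le> u'" for u u'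
    using assms(1,2) that by (simp_all add: mult_left_mono)
  consider (i) "pm \<le> 0 \<and> 0 \<le> pM \<and> qm < 0 \<and> 0 < qM" | (ii) "pm < 0 \<and> 0 < pM \<and> qm \<le> 0 \<and> 0 \<le> qM"
    | (iii) "pm < 0 \<and> 0 \<le> pM \<and> qm < 0 \<and> 0 \<le> qM" | (iv) "pm \<le> 0 \<and> 0 < pM \<and> qm \<le> 0 \<and> 0 < qM"
    using assms(3) by blast
  then show ?thesis
  proof cases
    case i
    then show ?thesis
      by (intro exI[of _ s]) (auto simp: admissible_direction_def p)
  next
    case ii
    then show ?thesis
      by (intro exI[of _ t]) (auto simp: admissible_direction_def q)
  next
    case iii
    have "a * min s t + A \<le> 0" "b * min s t + B \<le> 0"
      using mono(1)[of "min s t" s] mono(2)[of "min s t" t] p q by auto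
    with iii show ?thesis
      by (intro exI[of _ "min s t"]) (auto simp: admissible_direction_def)
  next
    case iv
    have "0 \<le> a * max s t + A" "0 \<le> b * max s t + B"
      using mono(1)[of s "max s t"] mono(2)[of t "max s t"] p q by auto
    with iv show ?thesis
      by (intro exI[of _ "max s t"]) (auto simp: admissible_direction_def)
  qed
qed

text \<open>The choice \<open>u = - B / b\<close> cancels the second power. By the ratio condition
  and \<open>\<beta> \<ge> 0\<close>, the children contribute at most \<open>a / b * B\<close> to
  the first power, which is therefore nonpositive. Since \<open>B \<ge> 0\<close>, the invariant
  \<open>1 - u \<ge> 0\<close> passes on.\<close>

lemma admissible_pair_ratio:
  fixes a b :: real and a' b' \<beta> :: "'k \<Rightarrow> real"
  assumes pos: "0 < a" "0 < b" "\<And>k. k \<in> I \<Longrightarrow> 0 < b' k"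
    and ratio: "\<And>k. k \<in> I \<Longrightarrow> a' k / b' k \<le> a / b" and nonneg: "\<And>k. k \<in> I \<Longrightarrow> 0 \<le> \<beta> k"
    and bounds: "pm < 0 \<and> 0 \<le> pM \<and> qm \<le> 0 \<and> 0 \<le> qM"
  shows "\<exists>u. 0 \<le> 1 - u \<and> admissible_direction pm (a * u + (\<Sum>k\<in>I. a' k * \<beta> k)) pM
    \<and> admissible_direction qm (b * u + (\<Sum>k\<in>I. b' k * \<beta> k)) qM"
proof (intro exI conjI)
  define B where "B = (\<Sum>k\<in>I. b' k * \<beta> k)"
  have "a' k * \<beta> k \<le> a / b * (b' k * \<beta> k)" if "k \<in> I" for k
  proof -
    have "a' k \<le> a / b * b' k"
      using ratio[OF that] pos(3)[OF that] by (simp add: pos_divide_le_eq)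
    from mult_right_mono[OF this nonneg[OF that]] show ?thesis by (simp add: mult.assoc)
  qed
  then have "(\<Sum>k\<in>I. a' k * \<beta> k) \<le> a / b * B"
    unfolding B_def sum_distrib_left by (rule sum_mono)
  then show "admissible_direction pm (a * (- B / b) + (\<Sum>k\<in>I. a' k * \<beta> k)) pM"
    using bounds by (simp add: admissible_direction_def)
  show "admissible_direction qm (b * (- B / b) + (\<Sum>k\<in>I. b' k * \<beta> k)) qM"
    using bounds pos(2) by (simp add: admissible_direction_def flip: B_def)
  have "0 \<le> B" unfolding B_def
    using pos(3) nonneg by (intro sum_nonneg mult_nonneg_nonneg) (auto intro: less_imp_le)
  then show "0 \<le> 1 - (- B / b)" using pos(2) by simp
qed

section \<open>Strong duality of the power flow problems\<close>

lemma affine_map_socp1_point: "affine_map (socp1_point D)"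
proof -
  \<comment> \<open>With the argument split into \<open>fst x\<close> and \<open>snd x\<close>, the
    defining equation, which matches on pairs, can be unfolded.\<close>
  have "affine_map (\<lambda>x. socp1_point D (fst x, snd x))"
    unfolding socp1_point.simps path_sum_def by (intro affine_map_intros)
  then show ?thesis by simp
qed

lemma strong_duality_SOCP1:
  fixes D :: "('n::finite) opf_data"
  assumes "convex_on UNIV (cost D)" "bdd_below (range (cost D))" "strictly_feasible (OPF_SOCP1 D)"
  shows "strong_duality (OPF_SOCP1 D)"
proof (rule slater_strong_duality)
  have obj: "objective (OPF_SOCP1 D) = (\<lambda>x. cost D (\<chi> a. Re (fst (snd (snd (socp1_point D x))) $ a),
      snd (snd (snd (socp1_point D x))), fst (snd (socp1_point D x))))"
    by (simp add: OPF_SOCP1_def socp1_objective_def fun_eq_iff split_paired_all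
        del: socp1_point.simps) (metis cr_objective.simps prod.collapse)
  show "convex_on UNIV (objective (OPF_SOCP1 D))"
    unfolding obj
    by (intro convex_on_compose_affine_map[OF assms(1)] affine_map_intros affine_map_socp1_point)
  show "bdd_below (range (objective (OPF_SOCP1 D)))"
    using assms(2) by (rule bdd_below_mono) (auto simp: obj)
  show "affine_map (eq_map (OPF_SOCP1 D))"
    by (simp add: OPF_SOCP1_def affine_map_const)
  have "affine_map (\<lambda>x. socp1_ineq D (fst x, snd x))"
    unfolding socp1_ineq.simps path_sum_def socp1_p_def socp1_q_def by (intro affine_map_intros)
  then show "affine_map (ineq_map (OPF_SOCP1 D))" by (simp add: OPF_SOCP1_def)
  have "affine_map (\<lambda>x. socp1_cone D (fst x, snd x))"
    unfolding socp1_cone.simps path_sum_def by (intro affine_map_intros)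
  then show "affine_map (cone_map (OPF_SOCP1 D))" by (simp add: OPF_SOCP1_def)
qed (rule assms)

lemma strong_duality_Cr:
  fixes D :: "('n::finite) opf_data"
  assumes "convex_on UNIV (cost D)" "bdd_below (range (cost D))" "strictly_feasible (OPF_Cr D)"
  shows "strong_duality (OPF_Cr D)"
proof (rule slater_strong_duality)
  let ?t = "\<lambda>x :: 'n cr_point. (fst x, fst (snd x), fst (snd (snd x)), snd (snd (snd x)))"
  have obj: "objective (OPF_Cr D) =
      (\<lambda>x. cost D (\<chi> a. Re (fst (snd (snd x)) $ a), snd (snd (snd x)), fst (snd x)))"
    by (simp add: OPF_Cr_def fun_eq_iff)
  show "convex_on UNIV (objective (OPF_Cr D))"
    unfolding obj by (intro convex_on_compose_affine_map[OF assms(1)] affine_map_intros)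
  show "bdd_below (range (objective (OPF_Cr D)))"
    using assms(2) by (rule bdd_below_mono) (auto simp: obj)
  have "affine_map (\<lambda>x. cr_eq D (?t x))"
    unfolding cr_eq.simps volt_def by (intro affine_map_intros)
  then show "affine_map (eq_map (OPF_Cr D))" by (simp add: OPF_Cr_def)
  have "affine_map (\<lambda>x. cr_ineq D (?t x))"
    unfolding cr_ineq.simps by (intro affine_map_intros)
  then show "affine_map (ineq_map (OPF_Cr D))" by (simp add: OPF_Cr_def)
  have "affine_map (\<lambda>x. cr_cone D (?t x))"
    unfolding cr_cone.simps by (intro affine_map_intros)
  then show "affine_map (cone_map (OPF_Cr D))" by (simp add: OPF_Cr_def)
qed (rule assms)

theorem theorem1:
  fixes D :: "('n::finite) opf_data"
  assumes tree: "rooted_tree D"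
    and lmax_pos: "\<forall>i. lmax D i > 0"
    and cost_convex: "convex_on UNIV (cost D)"
    and A1: "bdd_below (range (cost D))"
    and A2: "\<forall>i. vmax D i > vref D \<and> vref D > vmin D i \<and> vmin D i > 0"
    and A3: "\<forall>i. res D i > 0 \<and> rea D i > 0"
    and C:
      "(\<forall>i. (pmin D i \<le> 0 \<and> 0 \<le> pmax D i \<and> qmin D i < 0 \<and> 0 < qmax D i)
          \<or> (pmin D i < 0 \<and> 0 < pmax D i \<and> qmin D i \<le> 0 \<and> 0 \<le> qmax D i)
          \<or> (pmin D i < 0 \<and> 0 \<le> pmax D i \<and> qmin D i < 0 \<and> 0 \<le> qmax D i)
          \<or> (pmin D i \<le> 0 \<and> 0 < pmax D i \<and> qmin D i \<le> 0 \<and> 0 < qmax D i))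
       \<or> ((\<forall>i. \<forall>k\<in>children D (Some i). res D i / rea D i \<ge> res D k / rea D k) \<and>
          (\<forall>i. pmin D i < 0 \<and> 0 \<le> pmax D i \<and> qmin D i \<le> 0 \<and> 0 \<le> qmax D i))
       \<or> ((\<forall>i. \<forall>k\<in>children D (Some i). res D i / rea D i \<le> res D k / rea D k) \<and>
          (\<forall>i. pmin D i \<le> 0 \<and> 0 \<le> pmax D i \<and> qmin D i < 0 \<and> 0 \<le> qmax D i))"
  shows "strictly_feasible (OPF_SOCP1 D) \<and> strictly_feasible (OPF_Cr D)
       \<and> strong_duality (OPF_SOCP1 D) \<and> strong_duality (OPF_Cr D)"
proof -
  have z: "imp D i \<noteq> 0" for i
    using A3[rule_format, of i] by (auto simp: res_def)
  have zsq: "0 < zsq D i" for i using z by (simp add: zsq_def)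
  have pos: "0 < res D i / zsq D i" "0 < rea D i / zsq D i" for i
    using A3 zsq by simp_all
  \<comment> \<open>The factors \<open>1 / zsq D i\<close> cancel in the ratios, which reduces them
    to those in the hypotheses.\<close>
  have ratio: "(res D i / zsq D i) / (rea D i / zsq D i) = res D i / rea D i"
    "(rea D i / zsq D i) / (res D i / zsq D i) = rea D i / res D i" for i
    using zsq[of i] by simp_all
  have inverse_ratio: "rea D k / res D k \<le> rea D i / res D i"
    if "res D i / rea D i \<le> res D k / rea D k" for i k
    using that A3 by (simp add: divide_simps mult.commute)
  have "\<exists>\<beta>. \<forall>i. direction_at D \<beta> i (1 - \<beta> i)"
    using C
  proof (elim disjE)
    assume C1: "\<forall>i. (pmin D i \<le> 0 \<and> 0 \<le> pmax D i \<and> qmin D i < 0 \<and> 0 < qmax D i)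
        \<or> (pmin D i < 0 \<and> 0 < pmax D i \<and> qmin D i \<le> 0 \<and> 0 \<le> qmax D i)
        \<or> (pmin D i < 0 \<and> 0 \<le> pmax D i \<and> qmin D i < 0 \<and> 0 \<le> qmax D i)
        \<or> (pmin D i \<le> 0 \<and> 0 < pmax D i \<and> qmin D i \<le> 0 \<and> 0 < qmax D i)"
    show ?thesis
    proof (rule direction_exists[OF tree, where Q = "\<lambda>_. True"])
      show "\<exists>u. True \<and> direction_at D \<beta> i u" for \<beta> i
        unfolding direction_at_def simp_thms
        by (rule admissible_pair[OF pos C1[rule_format]])
    qed
  next
    assume C2: "(\<forall>i. \<forall>k\<in>children D (Some i). res D i / rea D i \<ge> res D k / rea D k) \<and>
          (\<forall>i. pmin D i < 0 \<and> 0 \<le> pmax D i \<and> qmin D i \<le> 0 \<and> 0 \<le> qmax D i)"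
    show ?thesis
    proof (rule direction_exists[OF tree, where Q = "\<lambda>c. 0 \<le> c"])
      fix i and \<beta> :: "'n \<Rightarrow> real"
      assume "\<And>k. k \<in> children D (Some i) \<Longrightarrow> 0 \<le> \<beta> k"
      then show "\<exists>u. 0 \<le> 1 - u \<and> direction_at D \<beta> i u"
        unfolding direction_at_def
        by (intro admissible_pair_ratio pos) (use C2 in \<open>simp_all only: ratio\<close>)
    qed
  next
    assume C3: "(\<forall>i. \<forall>k\<in>children D (Some i). res D i / rea D i \<le> res D k / rea D k) \<and>
          (\<forall>i. pmin D i \<le> 0 \<and> 0 \<le> pmax D i \<and> qmin D i < 0 \<and> 0 \<le> qmax D i)"
    show ?thesis
    proof (rule direction_exists[OF tree, where Q = "\<lambda>c. 0 \<le> c"])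
      fix i and \<beta> :: "'n \<Rightarrow> real"
      assume "\<And>k. k \<in> children D (Some i) \<Longrightarrow> 0 \<le> \<beta> k"
      then show "\<exists>u. 0 \<le> 1 - u \<and> direction_at D \<beta> i u"
        \<comment> \<open>Active and reactive power exchange roles: here the active power is the one
          cancelled, and the ratios are inverted.\<close>
        unfolding direction_at_def conj_commute[of "admissible_direction (pmin D i) _ _"]
        by (intro admissible_pair_ratio pos) (use C3 inverse_ratio in \<open>simp_all only: ratio\<close>)
    qed
  qed
  then obtain \<beta> where "\<And>i. direction_at D \<beta> i (1 - \<beta> i)" by blast
  then have "admissible_direction (pmin D i) (socp1_p D 1 (\<chi> i. \<beta> i) i) (pmax D i)"
    "admissible_direction (qmin D i) (socp1_q D 1 (\<chi> i. \<beta> i) i) (qmax D i)" for i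
    by (simp_all add: direction_at_def socp1_p_def socp1_q_def)
  then have "strictly_feasible (OPF_SOCP1 D)"
    using strictly_feasible_SOCP1_if_direction[of D "\<chi> i. \<beta> i"] lmax_pos A2 z by blast
  moreover from this have "strictly_feasible (OPF_Cr D)"
    using strictly_feasible_Cr_if_SOCP1[OF tree z] by blast
  ultimately show ?thesis
    using strong_duality_SOCP1 strong_duality_Cr cost_convex A1 by blast
qed

end
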